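(* Let $k,k',n,n',m,m'\geq 2$ be integers with $n<m$, $n'<m'$, $n$ and $m$ coprime, and $n'$ and $m'$ coprime. Then $$W(k,n,m)\cong_{\mathrm{ref}}W(k',n',m')\iff k=k',\ n=n',\ \text{and } m=m'.$$
   Context: Toric reflection group: for $k,n,m\ge 2$ with $n<m$ coprime, $W(k,n,m)$ is the group with generators $x_1,\dots,x_n$ and relations $x_i^k=1$ for $i=1,\dots,n$, and $x_1x_2\cdots x_m=x_ix_{i+1}\cdots x_{i+m-1}$ for $i=2,\dots,n$, indices of the $x_j$ being taken modulo $n$. The set of reflections of $W(k,n,m)$ is $R=\{g x_i^{\ell}g^{-1}\mid 1\le i\le n,\ g\in W(k,n,m),\ \ell\in\mathbb{Z},\ x_i^\ell\ne 1\}$. Two toric reflection groups $W,W'$ with respective sets of reflections $R,R'$ are reflection isomorphic, written $W\cong_{\mathrm{ref}}W'$, if there is a group isomorphism $\varphi:W\to W'$ with $\varphi(R)=R'$. *)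

theory Defs
  imports "HOL-Algebra.Group"
begin

(* Group presentations. The letter (x, True) stands for the generator x and
   (x, False) for its formal inverse. *)

type_synonym 'a word = "('a \<times> bool) list"

definition words :: "'a set \<Rightarrow> 'a word set" where
  "words S = lists (S \<times> UNIV)"

definition word_inv :: "'a word \<Rightarrow> 'a word" where
  "word_inv w = rev (map (\<lambda>(x, b). (x, \<not> b)) w)"

(* A pair (u, v) in R is the relation u = v. The membership premises of rel only
   discard pairs that are not words in the generators. *)
inductive pres_cong :: "'a set \<Rightarrow> ('a word \<times> 'a word) set \<Rightarrow> 'a word \<Rightarrow> 'a word \<Rightarrow> bool"
  for S :: "'a set" and R :: "('a word \<times> 'a word) set" where
  refl: "u \<in> words S \<Longrightarrow> pres_cong S R u u"
| sym: "pres_cong S R u v \<Longrightarrow> pres_cong S R v u"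
| trans: "pres_cong S R u v \<Longrightarrow> pres_cong S R v w \<Longrightarrow> pres_cong S R u w"
| append: "pres_cong S R u u' \<Longrightarrow> pres_cong S R v v' \<Longrightarrow> pres_cong S R (u @ v) (u' @ v')"
| cancel: "x \<in> S \<Longrightarrow> pres_cong S R [(x, b), (x, \<not> b)] []"
| rel: "(u, v) \<in> R \<Longrightarrow> u \<in> words S \<Longrightarrow> v \<in> words S \<Longrightarrow> pres_cong S R u v"

definition pres_class :: "'a set \<Rightarrow> ('a word \<times> 'a word) set \<Rightarrow> 'a word \<Rightarrow> 'a word set" where
  "pres_class S R w = {v. pres_cong S R w v}"

definition presented_group :: "'a set \<Rightarrow> ('a word \<times> 'a word) set \<Rightarrow> 'a word set monoid" where
  "presented_group S R =
     \<lparr>carrier = pres_class S R ` words S,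
      monoid.mult = (\<lambda>A B. \<Union>u\<in>A. \<Union>v\<in>B. pres_class S R (u @ v)),
      one = pres_class S R []\<rparr>"

(* The generator x_j of W(k,n,m), for j >= 1, with j reduced modulo n to
   the representative in {1..n}. *)
definition toric_letter :: "nat \<Rightarrow> nat \<Rightarrow> nat \<times> bool" where
  "toric_letter n j = ((j - 1) mod n + 1, True)"

definition toric_relations :: "nat \<Rightarrow> nat \<Rightarrow> nat \<Rightarrow> (nat word \<times> nat word) set" where
  "toric_relations k n m =
     {(replicate k (toric_letter n i), []) | i. i \<in> {1..n}} \<union>
     {(map (toric_letter n) [1..<m + 1], map (toric_letter n) [i..<i + m]) | i. i \<in> {2..n}}"

definition toric_group :: "nat \<Rightarrow> nat \<Rightarrow> nat \<Rightarrow> nat word set monoid" where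
  "toric_group k n m = presented_group {1..n} (toric_relations k n m)"

definition toric_gen :: "nat \<Rightarrow> nat \<Rightarrow> nat \<Rightarrow> nat \<Rightarrow> nat word set" where
  "toric_gen k n m i = pres_class {1..n} (toric_relations k n m) [toric_letter n i]"

definition toric_reflections :: "nat \<Rightarrow> nat \<Rightarrow> nat \<Rightarrow> nat word set set" where
  "toric_reflections k n m =
     (let W = toric_group k n m; x = toric_gen k n m in
      {g \<otimes>\<^bsub>W\<^esub> (x i [^]\<^bsub>W\<^esub> l) \<otimes>\<^bsub>W\<^esub> inv\<^bsub>W\<^esub> g | i g (l::int).
         i \<in> {1..n} \<and> g \<in> carrier W \<and> x i [^]\<^bsub>W\<^esub> l \<noteq> \<one>\<^bsub>W\<^esub>})"

definition reflection_isomorphic ::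
  "('a, 'c) monoid_scheme \<Rightarrow> 'a set \<Rightarrow> ('b, 'd) monoid_scheme \<Rightarrow> 'b set \<Rightarrow> bool" where
  "reflection_isomorphic G R H R' \<longleftrightarrow> (\<exists>\<phi>\<in>iso G H. \<phi> ` R = R')"

lemma words_Nil [simp]: "[] \<in> words S"
  and words_append [simp]: "u @ v \<in> words S \<longleftrightarrow> u \<in> words S \<and> v \<in> words S"
  and words_Cons [simp]: "p # u \<in> words S \<longleftrightarrow> fst p \<in> S \<and> u \<in> words S"
  by (auto simp: words_def mem_Times_iff)

lemma word_inv_words [simp]: "w \<in> words S \<Longrightarrow> word_inv w \<in> words S"
  by (auto simp: words_def word_inv_def)

lemma pres_cong_words: "pres_cong S R u v \<Longrightarrow> u \<in> words S \<and> v \<in> words S"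
  by (induction rule: pres_cong.induct) auto

lemma pres_class_eq_iff:
  assumes "u \<in> words S"
  shows "pres_class S R u = pres_class S R v \<longleftrightarrow> pres_cong S R u v"
proof
  assume "pres_class S R u = pres_class S R v"
  with assms show "pres_cong S R u v"
    using pres_cong.sym[of S R v u] pres_cong.refl[of u S R] by (auto simp: pres_class_def set_eq_iff)
next
  assume "pres_cong S R u v"
  then show "pres_class S R u = pres_class S R v"
    unfolding pres_class_def using pres_cong.sym pres_cong.trans by blast
qed

lemma carrier_presented_group: "carrier (presented_group S R) = pres_class S R ` words S"
  and one_presented_group: "\<one>\<^bsub>presented_group S R\<^esub> = pres_class S R []"
  by (simp_all add: presented_group_def)

lemma mult_pres_class:
  assumes "u \<in> words S" "v \<in> words S"
  shows "pres_class S R u \<otimes>\<^bsub>presented_group S R\<^esub> pres_class S R v = pres_class S R (u @ v)"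
proof -
  have "pres_class S R (u' @ v') = pres_class S R (u @ v)"
    if "pres_cong S R u u'" "pres_cong S R v v'" for u' v'
    using assms pres_cong.append[OF that] pres_class_eq_iff[of "u @ v" S R "u' @ v'"] by simp
  then have "(\<Union>u'\<in>pres_class S R u. \<Union>v'\<in>pres_class S R v. pres_class S R (u' @ v')) =
      (\<Union>u'\<in>pres_class S R u. \<Union>v'\<in>pres_class S R v. pres_class S R (u @ v))"
    by (simp add: pres_class_def)
  moreover have "pres_class S R u \<noteq> {}" "pres_class S R v \<noteq> {}"
    using assms pres_cong.refl by (auto simp: pres_class_def)
  ultimately show ?thesis
    by (simp add: presented_group_def)
qed

lemma word_inv_cancel: "w \<in> words S \<Longrightarrow> pres_cong S R (word_inv w @ w) []"
proof (induction w)
  case Nil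
  then show ?case by (simp add: word_inv_def pres_cong.refl)
next
  case (Cons p w)
  obtain x b where p: "p = (x, b)" by force
  have w: "w \<in> words S" and x: "x \<in> S" using Cons.prems p by auto
  have "pres_cong S R ([(x, \<not> b), (x, b)] @ w) ([] @ w)"
    using pres_cong.append[OF pres_cong.cancel[OF x, of R "\<not> b"] pres_cong.refl[OF w, of R]] by simp
  then have "pres_cong S R (word_inv w @ ([(x, \<not> b), (x, b)] @ w)) (word_inv w @ ([] @ w))"
    by (rule pres_cong.append[OF pres_cong.refl[OF word_inv_words[OF w]]])
  then have "pres_cong S R (word_inv w @ ([(x, \<not> b), (x, b)] @ w)) []"
    using Cons.IH[OF w] by (simp add: pres_cong.trans)
  then show ?case by (simp add: p word_inv_def)
qed

lemma group_presented_group: "group (presented_group S R)"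
proof (rule groupI)
  fix g assume "g \<in> carrier (presented_group S R)"
  then obtain w where w: "w \<in> words S" and g: "g = pres_class S R w"
    by (auto simp: carrier_presented_group)
  have "pres_class S R (word_inv w) \<otimes>\<^bsub>presented_group S R\<^esub> g = \<one>\<^bsub>presented_group S R\<^esub>"
    using w word_inv_cancel[OF w, of R]
    by (simp add: g mult_pres_class one_presented_group pres_class_eq_iff)
  moreover have "pres_class S R (word_inv w) \<in> carrier (presented_group S R)"
    using w by (simp add: carrier_presented_group)
  ultimately show "\<exists>h\<in>carrier (presented_group S R).
      h \<otimes>\<^bsub>presented_group S R\<^esub> g = \<one>\<^bsub>presented_group S R\<^esub>" by blast
qed (auto simp: carrier_presented_group one_presented_group mult_pres_class)

definition word_eval :: "('b, 'c) monoid_scheme \<Rightarrow> ('a \<Rightarrow> 'b) \<Rightarrow> 'a word \<Rightarrow> 'b" where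
  "word_eval G f w =
     foldr (\<lambda>(x, b) g. (if b then f x else inv\<^bsub>G\<^esub> (f x)) \<otimes>\<^bsub>G\<^esub> g) w \<one>\<^bsub>G\<^esub>"

lemma word_eval_simps [simp]:
  "word_eval G f [] = \<one>\<^bsub>G\<^esub>"
  "word_eval G f ((x, b) # w) =
     (if b then f x else inv\<^bsub>G\<^esub> (f x)) \<otimes>\<^bsub>G\<^esub> word_eval G f w"
  by (simp_all add: word_eval_def)

lemma word_eval_closed:
  assumes "group G" "f \<in> S \<rightarrow> carrier G" "w \<in> words S"
  shows "word_eval G f w \<in> carrier G"
proof -
  interpret group G by fact
  show ?thesis using assms(3)
  proof (induction w)
    case (Cons p w)
    then show ?case using assms(2) by (cases p) (auto simp: Pi_iff)
  qed simp
qed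

lemma word_eval_append:
  assumes "group G" "f \<in> S \<rightarrow> carrier G" "u \<in> words S" "v \<in> words S"
  shows "word_eval G f (u @ v) = word_eval G f u \<otimes>\<^bsub>G\<^esub> word_eval G f v"
proof -
  interpret group G by fact
  show ?thesis using assms(3)
  proof (induction u)
    case Nil
    then show ?case using word_eval_closed[OF assms(1,2,4)] by simp
  next
    case (Cons p u)
    then have "word_eval G f u \<in> carrier G" using word_eval_closed[OF assms(1,2)] by simp
    then show ?case using Cons assms(2) word_eval_closed[OF assms(1,2,4)]
      by (cases p) (auto simp: Pi_iff m_assoc)
  qed
qed

(* Universal property (von Dyck): assignments of the generators that satisfy the
   relations extend to homomorphisms. *)
theorem presented_group_universal:
  assumes G: "group G" and f: "f \<in> S \<rightarrow> carrier G" and R: "R \<subseteq> words S \<times> words S"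
    and sat: "\<And>u v. (u, v) \<in> R \<Longrightarrow> word_eval G f u = word_eval G f v"
  shows "\<exists>h\<in>hom (presented_group S R) G. \<forall>x\<in>S. h (pres_class S R [(x, True)]) = f x"
proof -
  interpret group G by fact
  have cong: "word_eval G f u = word_eval G f v" if "pres_cong S R u v" for u v
    using that
  proof (induction rule: pres_cong.induct)
    case (append u u' v v')
    then show ?case
      using pres_cong_words[OF append.hyps(1)] pres_cong_words[OF append.hyps(2)]
      by (simp add: word_eval_append[OF G f])
  next
    case (cancel x b)
    then show ?case using f by (auto simp: Pi_iff)
  qed (auto simp: sat)
  define h where "h A = word_eval G f (SOME w. w \<in> A)" for A
  have h: "h (pres_class S R w) = word_eval G f w" if "w \<in> words S" for w
  proof -
    have "w \<in> pres_class S R w" using that by (simp add: pres_class_def pres_cong.refl)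
    then have "(SOME v. v \<in> pres_class S R w) \<in> pres_class S R w" by (rule someI)
    then show ?thesis using cong by (simp add: h_def pres_class_def)
  qed
  have "h \<in> hom (presented_group S R) G"
    by (rule homI)
      (auto simp: carrier_presented_group mult_pres_class h word_eval_closed[OF G f]
         word_eval_append[OF G f])
  moreover have "h (pres_class S R [(x, True)]) = f x" if "x \<in> S" for x
    using that f by (auto simp: h Pi_iff)
  ultimately show ?thesis by blast
qed

lemma toric_relations_words:
  assumes "n \<ge> 1"
  shows "toric_relations k n m \<subseteq> words {1..n} \<times> words {1..n}"
proof -
  have "fst (toric_letter n j) \<in> {1..n}" for j
    using assms by (simp add: toric_letter_def Suc_le_eq)
  then have "map (toric_letter n) js \<in> words {1..n}" "replicate l (toric_letter n i) \<in> words {1..n}"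
    for js l i
    by (induction js, simp_all) (induction l, simp_all)
  then show ?thesis by (auto simp: toric_relations_def simp del: upt_Suc)
qed

end

(* A reflection isomorphism transports the finite-dimensional representations in which every
   reflection fixes a hyperplane and no nonzero vector is fixed by the whole group. With
   n t = m s + 1, the group W(k,n,m) is generated by alpha = (x_1 ... x_m)^s and
   beta = (x_1 ... x_n)^t = alpha x_n, some powers of which are central. Since W is generated by
   n reflections, such a representation has dimension at most n. In dimension n, let f be a linear
   form vanishing on the hyperplane fixed by x_n: in the basis f, f alpha, ..., f alpha^(n-1) of the
   dual space, alpha and beta become companion matrices, and the representation is determined up
   to equivalence by the nontrivial eigenvalue zeta of x_n (a k-th root of unity) and by the set of
   eigenvalues of beta (an n-subset, with prescribed product, of the m-th roots of a number
   depending on zeta). Conversely all these data occur, so that there are exactly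
   (k - 1) binomial(m,n) / m classes. Hence n is the largest dimension of such a representation,
   m is recovered from the number of classes, and k is the number of homomorphisms to the
   multiplicative group of the complex numbers. *)

theory Submission
  imports Defs "Jordan_Normal_Form.Spectral_Radius"
begin

section \<open>The generators of the toric groups\<close>

text \<open>What replaces it is the absence of fixed vectors: a vector on which all f alpha^j with j
  < n vanish is fixed by every conjugate alpha^(-j) x_n alpha^j, and these conjugates are all the
  generators. Hence the forms separate vectors, and the central element gamma = (x_1 ... x_m)^n acts
  as a scalar mu. Nor is mu a free parameter. Since alpha^n = gamma^s and beta^m = gamma^t, the
  eigenvalues of beta are m-th roots of mu^t, and their product is (-1)^(n+1) zeta mu^s. The m-th
  power of this product is also mu^(n t) = mu^(m s + 1), which forces mu = ((-1)^(n+1) zeta)^m. So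
  zeta alone fixes both the number whose roots are taken and the prescribed product. A set of
  eigenvalues, without multiplicities, is enough because X^m - mu^t has simple roots.\<close>

primrec consecutive_prod :: "('b, 'c) monoid_scheme \<Rightarrow> (nat \<Rightarrow> 'b) \<Rightarrow> nat \<Rightarrow> nat \<Rightarrow> 'b" where
  "consecutive_prod G y i 0 = \<one>\<^bsub>G\<^esub>"
| "consecutive_prod G y i (Suc l) = consecutive_prod G y i l \<otimes>\<^bsub>G\<^esub> y (i + l)"

text \<open>The index runs over all natural numbers, \<open>y j\<close> standing for x_(j+1) with
  period n, and the product relation is demanded at every starting index; windows of letters can
  then be shifted without reducing indices modulo n.\<close>

definition toric_tuple ::
  "('b, 'c) monoid_scheme \<Rightarrow> nat \<Rightarrow> nat \<Rightarrow> nat \<Rightarrow> (nat \<Rightarrow> 'b) \<Rightarrow> bool" where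
  "toric_tuple G k n m y \<longleftrightarrow>
     (\<forall>j. y j \<in> carrier G) \<and> (\<forall>j. y (j + n) = y j) \<and> (\<forall>j. y j [^]\<^bsub>G\<^esub> k = \<one>\<^bsub>G\<^esub>) \<and>
     (\<forall>i. consecutive_prod G y i m = consecutive_prod G y 0 m)"

lemma periodic_mod:
  fixes y :: "nat \<Rightarrow> 'b"
  assumes "\<And>j. y (j + n) = y j"
  shows "y (j mod n) = y j"
proof -
  have *: "y (i + q * n) = y i" for i q
    by (induction q) (use assms[of "i + _ * n"] in \<open>simp_all add: algebra_simps\<close>)
  show ?thesis using *[of "j mod n" "j div n"] by simp
qed

context group
begin

lemma commute_solve:
  assumes "a \<otimes> b = b \<otimes> a" "a \<in> carrier G" "b \<in> carrier G"
  shows "inv a \<otimes> b = b \<otimes> inv a"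
  using assms by (metis inv_closed inv_solve_left inv_solve_right m_assoc m_closed)

lemma pow_comm: "x \<in> carrier G \<Longrightarrow> x [^] (j::nat) \<otimes> x = x \<otimes> x [^] j"
  using nat_pow_comm[of x j 1] by simp

lemma consecutive_prod_closed [simp]:
  "(\<And>j. y j \<in> carrier G) \<Longrightarrow> consecutive_prod G y i l \<in> carrier G"
  by (induction l) auto

lemma consecutive_prod_add:
  "(\<And>j. y j \<in> carrier G) \<Longrightarrow>
   consecutive_prod G y i (a + b) = consecutive_prod G y i a \<otimes> consecutive_prod G y (i + a) b"
  by (induction b) (auto simp: m_assoc add.assoc)

lemma consecutive_prod_shift:
  assumes "\<And>j. y (j + p) = y j"
  shows "consecutive_prod G y (i + p) l = consecutive_prod G y i l"
  proof (induction l)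
  case (Suc l)
  have "i + p + l = i + l + p" by simp
  then show ?case using Suc by (simp only: consecutive_prod.simps assms)
qed simp

lemma consecutive_prod_pow:
  assumes y: "\<And>j. y j \<in> carrier G" and c: "\<And>q. consecutive_prod G y (i + l * q) l = z"
  shows "consecutive_prod G y i (l * q) = z [^] q"
proof (induction q)
  case (Suc q)
  have "l * Suc q = l * q + l" by simp
  then show ?case using consecutive_prod_add[where y = y and i = i and a = "l * q" and b = l, OF y] Suc c[of q]
    by (simp add: add.commute)
qed auto

end

section \<open>Consequences of the toric relations for \<alpha> and \<beta>, in any group\<close>

locale toric_pair = group G for G (structure) +
  fixes k n m s t :: nat and y
  assumes tuple: "toric_tuple G k n m y" and n_pos: "n \<ge> 1" and st: "n * t = m * s + 1"
begin

abbreviation cp where "cp \<equiv> consecutive_prod G y"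
text \<open>\<open>Z\<close> is the product of m consecutive letters, the same from every starting
  letter; \<open>\<gamma>\<close> is the central element of which both \<open>\<alpha> [^] n\<close>
  and \<open>\<beta> [^] m\<close> are powers.\<close>

definition "Z = cp 0 m"
definition "\<alpha> = Z [^] s"
definition "\<beta> = cp 0 n [^] t"
definition "\<gamma> = Z [^] n"

lemma y [simp]: "y j \<in> carrier G" and per: "y (j + n) = y j" and ypow: "y j [^] k = \<one>"
  and rel: "cp i m = cp 0 m"
  using tuple by (auto simp: toric_tuple_def)

lemma closed [simp]: "Z \<in> carrier G" "\<alpha> \<in> carrier G" "\<beta> \<in> carrier G" "\<gamma> \<in> carrier G"
  by (auto simp: Z_def \<alpha>_def \<beta>_def \<gamma>_def)

lemma per_mult: "y (j + n * q) = y j"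
  by (induction q) (use per[of "j + n * _"] in \<open>simp_all add: algebra_simps\<close>)

lemma cp_Z: "cp i (m * q) = Z [^] q"
  by (rule consecutive_prod_pow) (auto simp: Z_def intro: rel)

lemma cp_Y: "cp 0 (n * q) = cp 0 n [^] q"
proof (rule consecutive_prod_pow)
  show "cp (0 + n * q) n = cp 0 n" for q
    using consecutive_prod_shift[of y "n * q" 0 n] per_mult by simp
qed auto

text \<open>The window of m + 1 letters starting at j is split once after its first letter and once
  before its last one.\<close>

lemma y_Z: "y j \<otimes> Z = Z \<otimes> y (j + m)"
proof -
  have "cp j (1 + m) = cp j (m + 1)" by simp
  then show ?thesis
    unfolding consecutive_prod_add[OF y] using rel[of j] rel[of "j+1"] by (simp add: Z_def)
qed

lemma y_Z_pow: "y j \<otimes> Z [^] q = Z [^] q \<otimes> y (j + m * q)"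
proof (induction q)
  case (Suc q)
  have "y j \<otimes> Z [^] Suc q = Z [^] q \<otimes> (y (j + m * q) \<otimes> Z)"
    using Suc by (simp add: m_assoc[symmetric])
  also have "\<dots> = Z [^] Suc q \<otimes> y (j + m * Suc q)"
    unfolding y_Z by (simp add: m_assoc algebra_simps)
  finally show ?case .
qed auto

text \<open>The n t = m s + 1 letters from index 0 are read as t blocks of length n, and as one
  letter followed by s blocks of length m.\<close>

lemma \<beta>_eq: "\<beta> = y 0 \<otimes> \<alpha>"
proof -
  have "\<beta> = cp 0 (1 + m * s)" by (simp add: \<beta>_def cp_Y[symmetric] st)
  also have "\<dots> = y 0 \<otimes> \<alpha>"
    unfolding consecutive_prod_add[OF y] by (simp add: cp_Z \<alpha>_def)
  finally show ?thesis .
qed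

text \<open>Passing \<open>\<alpha>\<close> moves an index by m s, which is -1 modulo n; conjugation
  by \<open>\<alpha>\<close> therefore runs through all the generators.\<close>

lemma y_Suc_\<alpha>: "y (Suc j) \<otimes> \<alpha> = \<alpha> \<otimes> y j"
proof -
  have "Suc j + m * s = j + n * t" using st by simp
  then show ?thesis unfolding \<alpha>_def y_Z_pow by (simp only: per_mult)
qed

lemma \<alpha>_y_pow: "\<alpha> [^] j \<otimes> y i = y (i + j) \<otimes> \<alpha> [^] j"
proof (induction j)
  case (Suc j)
  have "\<alpha> [^] Suc j \<otimes> y i = \<alpha> \<otimes> (\<alpha> [^] j \<otimes> y i)"
    by (simp add: m_assoc[symmetric] pow_comm)
  also have "\<dots> = (y (Suc (i + j)) \<otimes> \<alpha>) \<otimes> \<alpha> [^] j"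
    unfolding Suc y_Suc_\<alpha> by (simp add: m_assoc)
  also have "\<dots> = y (i + Suc j) \<otimes> \<alpha> [^] Suc j"
    by (simp add: m_assoc pow_comm)
  finally show ?case .
qed auto

text \<open>Every generator is a word in \<open>\<alpha>\<close> and \<open>\<beta>\<close>, so a
  homomorphism is determined by its values at these two elements.\<close>

lemma y_conj: "y j = \<alpha> [^] j \<otimes> (\<beta> \<otimes> inv \<alpha>) \<otimes> inv (\<alpha> [^] j)"
proof -
  have "y 0 = \<beta> \<otimes> inv \<alpha>" by (simp add: \<beta>_eq m_assoc)
  moreover have "y j = \<alpha> [^] j \<otimes> y 0 \<otimes> inv (\<alpha> [^] j)"
    using \<alpha>_y_pow[of j 0] by (simp add: inv_solve_right)
  ultimately show ?thesis by simp
qed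

lemma \<alpha>_y_last: "\<alpha> \<otimes> y (n - 1) = \<beta>"
  using y_Suc_\<alpha>[of "n - 1"] n_pos per[of 0] by (simp add: \<beta>_eq)

lemma \<alpha>_pow: "\<alpha> [^] n = \<gamma> [^] s"
  by (simp add: \<alpha>_def \<gamma>_def nat_pow_pow mult.commute)

text \<open>Both (x_1 ... x_n)^m and (x_1 ... x_m)^n are the product of the n m letters from index
  0.\<close>

lemma \<beta>_pow: "\<beta> [^] m = \<gamma> [^] t"
proof -
  have "cp 0 n [^] m = Z [^] n" using cp_Y[of m] cp_Z[of 0 n] by (simp add: mult.commute)
  then have "(cp 0 n [^] m) [^] t = \<gamma> [^] t" by (simp add: \<gamma>_def)
  then show ?thesis by (simp add: \<beta>_def nat_pow_pow mult.commute)
qed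

text \<open>Passing \<open>Z [^] n\<close> moves an index by m n, a multiple of the period.\<close>

lemma \<gamma>_y: "y j \<otimes> \<gamma> = \<gamma> \<otimes> y j"
  unfolding \<gamma>_def y_Z_pow by (simp add: mult.commute[of m] per_mult)

lemma \<gamma>_\<alpha>: "\<alpha> \<otimes> \<gamma> = \<gamma> \<otimes> \<alpha>"
  unfolding \<gamma>_def \<alpha>_def by (simp add: nat_pow_comm)

end

context group
begin

text \<open>Telescoping gives \<open>y 0 \<dots> y (l - 1) = B\<^sup>l A\<^sup>-\<^sup>l\<close>, from which \<open>n * t = m * s + 1\<close> recovers
  \<open>A\<close> and \<open>B\<close> as the values of \<open>\<alpha>\<close> and \<open>\<beta>\<close>.\<close>

lemma toric_tuple_of_pair:
  fixes k n m s t :: nat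
  assumes A: "A \<in> carrier G" and B: "B \<in> carrier G" and st: "n * t = m * s + 1"
    and cA: "A [^] n \<otimes> B = B \<otimes> A [^] n" and cB: "B [^] m \<otimes> A = A \<otimes> B [^] m"
    and k: "(B \<otimes> inv A) [^] k = \<one>" and eq: "(A [^] n) [^] t = (B [^] m) [^] s"
  defines "y \<equiv> \<lambda>j::nat. A [^] j \<otimes> (B \<otimes> inv A) \<otimes> inv (A [^] j)"
  shows "toric_tuple G k n m y"
    and "consecutive_prod G y 0 m [^] s = A" and "consecutive_prod G y 0 n [^] t = B"
proof -
  note [simp] = A B
  have y [simp]: "y j \<in> carrier G" for j by (simp add: y_def)
  have prod: "consecutive_prod G y i l \<otimes> A [^] (i + l) = A [^] i \<otimes> B [^] l" for i l
  proof (induction l)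
    case (Suc l)
    have "y (i + l) \<otimes> A [^] (i + Suc l) = A [^] (i + l) \<otimes> B"
      by (simp add: y_def m_assoc inv_solve_left' pow_comm)
    then have "consecutive_prod G y i (Suc l) \<otimes> A [^] (i + Suc l) =
        (consecutive_prod G y i l \<otimes> A [^] (i + l)) \<otimes> B"
      by (simp add: m_assoc)
    then show ?case by (simp add: Suc m_assoc)
  qed auto
  have Am: "A [^] i \<otimes> B [^] m = B [^] m \<otimes> A [^] i" for i :: nat
    using group_commutes_pow[of A "B [^] m" i] cB by simp
  have An: "A [^] n \<otimes> B [^] i = B [^] i \<otimes> A [^] n" for i :: nat
    using group_commutes_pow[of B "A [^] n" i] cA by simp
  \<comment> \<open>The starting index cancels because \<open>B [^] m\<close> commutes with
    \<open>A\<close>; this is the product relation.\<close>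
  have prod_m: "consecutive_prod G y i m \<otimes> A [^] m = B [^] m" for i
  proof -
    have "consecutive_prod G y i m \<otimes> A [^] m \<otimes> A [^] i = B [^] m \<otimes> A [^] i"
      using prod[of i m] Am[of i] by (simp add: m_assoc nat_pow_mult add.commute)
    then show ?thesis by simp
  qed
  have shift: "y (j + n) = y j" for j
  proof -
    have *: "A [^] n \<otimes> (B \<otimes> inv A) = (B \<otimes> inv A) \<otimes> A [^] n"
    proof -
      have "inv A \<otimes> A [^] n = A [^] n \<otimes> inv A"
        by (rule commute_solve) (auto simp: pow_comm)
      then show ?thesis using cA by (simp add: m_assoc) (simp add: m_assoc[symmetric])
    qed
    have "y (j + n) = A [^] j \<otimes> (A [^] n \<otimes> (B \<otimes> inv A)) \<otimes> inv (A [^] n) \<otimes> inv (A [^] j)"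
      by (simp add: y_def nat_pow_mult[symmetric, of A j n] m_assoc inv_mult_group)
    also have "\<dots> = y j" unfolding * by (simp add: y_def m_assoc)
    finally show ?thesis .
  qed
  have pow: "y j [^] k = \<one>" for j
  proof -
    have "y j [^] l = A [^] j \<otimes> (B \<otimes> inv A) [^] l \<otimes> inv (A [^] j)" for l :: nat
    proof (induction l)
      case (Suc l)
      then show ?case by (simp add: y_def m_assoc) (simp add: m_assoc[symmetric])
    qed (auto simp: y_def)
    then show ?thesis using k by simp
  qed
  show "toric_tuple G k n m y"
    unfolding toric_tuple_def
  proof (intro conjI allI)
    show "consecutive_prod G y i m = consecutive_prod G y 0 m" for i
      using prod_m[of i] prod_m[of 0] by (metis A consecutive_prod_closed nat_pow_closed right_cancel y)
  qed (auto simp: shift pow)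
  define Z where "Z = consecutive_prod G y 0 m"
  define Y where "Y = consecutive_prod G y 0 n"
  have [simp]: "Z \<in> carrier G" "Y \<in> carrier G" by (simp_all add: Z_def Y_def)
  have Z: "Z \<otimes> A [^] m = B [^] m" unfolding Z_def by (rule prod_m)
  have Y: "Y \<otimes> A [^] n = B [^] n" using prod[of 0 n] by (simp add: Y_def)
  have comZ: "Z \<otimes> A [^] m = A [^] m \<otimes> Z"
  proof -
    have "A [^] m \<otimes> Z \<otimes> A [^] m = Z \<otimes> A [^] m \<otimes> A [^] m"
      using Am[of m] by (simp add: m_assoc Z)
    then show ?thesis by simp
  qed
  have comY: "Y \<otimes> A [^] n = A [^] n \<otimes> Y"
  proof -
    have "A [^] n \<otimes> Y \<otimes> A [^] n = Y \<otimes> A [^] n \<otimes> A [^] n"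
      using An[of n] by (simp add: m_assoc Y)
    then show ?thesis by simp
  qed
  \<comment> \<open>As \<open>Z\<close> commutes with \<open>A [^] m\<close>, Z^s A^(m s) = (Z
    A^m)^s = B^(m s) = A^(n t) = A^(m s + 1), and cancelling leaves \<open>A\<close>. The
    computation for \<open>B\<close> is parallel, with \<open>Y\<close> and n.\<close>
  have "Z [^] s \<otimes> A [^] (m * s) = (B [^] m) [^] s"
    using pow_mult_distrib[OF comZ, of s] by (simp add: Z nat_pow_pow)
  also have "\<dots> = A [^] (m * s + 1)" unfolding eq[symmetric] st[symmetric] by (simp add: nat_pow_pow)
  also have "\<dots> = A \<otimes> A [^] (m * s)" by (simp add: pow_comm)
  finally show "consecutive_prod G y 0 m [^] s = A" by (simp add: Z_def)
  have "Y [^] t \<otimes> A [^] (n * t) = B [^] (n * t)"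
    using pow_mult_distrib[OF comY, of t] by (simp add: Y nat_pow_pow)
  also have "\<dots> = B \<otimes> (B [^] m) [^] s"
    unfolding st by (simp add: nat_pow_pow pow_comm)
  also have "\<dots> = B \<otimes> A [^] (n * t)" unfolding eq[symmetric] by (simp add: nat_pow_pow)
  finally show "consecutive_prod G y 0 n [^] t = B" by (simp add: Y_def)
qed

end

section \<open>The toric group as the universal group with a toric tuple\<close>

lemma group_toric_group: "group (toric_group k n m)"
  by (simp add: toric_group_def group_presented_group)

text \<open>The presentation counts letters from 1 and the tuple from 0, so the letters from
  \<open>Suc i\<close> on give the window that starts at \<open>i\<close>.\<close>

lemma word_eval_map_letter:
  assumes G: "group G" and y: "\<And>j. y j \<in> carrier G" and per: "\<And>j. y (j + n) = y j" and n: "n \<ge> 1"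
  shows "word_eval G (\<lambda>x. y (x - 1)) (map (toric_letter n) [Suc i..<Suc i + l]) = consecutive_prod G y i l"
proof -
  interpret group G by fact
  have letter: "fst (toric_letter n j) \<in> {1..n}" for j
    using n by (simp add: toric_letter_def Suc_le_eq)
  have words: "map (toric_letter n) js \<in> words {1..n}" for js
    by (induction js) (use letter in auto)
  show ?thesis
  proof (induction l)
    case (Suc l)
    have "[Suc i..<Suc i + Suc l] = [Suc i..<Suc i + l] @ [Suc (i + l)]" by simp
    then have "word_eval G (\<lambda>x. y (x - 1)) (map (toric_letter n) [Suc i..<Suc i + Suc l]) =
      word_eval G (\<lambda>x. y (x - 1)) (map (toric_letter n) [Suc i..<Suc i + l] @ [toric_letter n (Suc (i + l))])"
      by (simp del: upt_Suc)
    also have "\<dots> = consecutive_prod G y i l \<otimes>\<^bsub>G\<^esub>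
        word_eval G (\<lambda>x. y (x - 1)) [toric_letter n (Suc (i + l))]"
      using word_eval_append[OF G, of "\<lambda>x. y (x - 1)" "{1..n}"
          "map (toric_letter n) [Suc i..<Suc i + l]" "[toric_letter n (Suc (i + l))]"]
        words letter y Suc by (simp add: Pi_iff del: upt_Suc)
    also have "\<dots> = consecutive_prod G y i (Suc l)"
      using periodic_mod[of y n, OF per] y by (simp add: toric_letter_def)
    finally show ?case .
  qed auto
qed

text \<open>The source of the homomorphisms built below: matrix representations and characters alike
  only require a toric tuple in the target group.\<close>

lemma hom_of_toric_tuple:
  assumes G: "group G" and y: "toric_tuple G k n m y" and n: "n \<ge> 1"
  shows "\<exists>h\<in>hom (toric_group k n m) G. \<forall>j. h (toric_gen k n m (Suc j)) = y j"
proof -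
  interpret group G by fact
  have yc: "\<And>j. y j \<in> carrier G" and per: "\<And>j. y (j + n) = y j" and pow: "\<And>j. y j [^]\<^bsub>G\<^esub> k = \<one>\<^bsub>G\<^esub>"
    and rel: "\<And>i. consecutive_prod G y i m = consecutive_prod G y 0 m"
    using y by (auto simp: toric_tuple_def)
  let ?f = "\<lambda>x. y (x - 1)"
  have f: "?f \<in> {1..n} \<rightarrow> carrier G" using yc by auto
  have mod: "y (j mod n) = y j" for j using periodic_mod[of y n, OF per] .
  have sat: "word_eval G ?f u = word_eval G ?f v" if uv: "(u, v) \<in> toric_relations k n m" for u v
  proof -
    consider i where "u = replicate k (toric_letter n i)" "v = []" "i \<in> {1..n}"
      | i where "u = map (toric_letter n) [1..<m + 1]" "v = map (toric_letter n) [i..<i + m]" "i \<in> {2..n}"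
      using uv by (auto simp: toric_relations_def simp del: upt_Suc)
    then show ?thesis
    proof cases
      case 1
      have "word_eval G ?f (replicate l (toric_letter n i)) = y (i - 1) [^]\<^bsub>G\<^esub> l" for l
        by (induction l) (use yc mod in \<open>auto simp: toric_letter_def pow_comm\<close>)
      then show ?thesis using 1 pow by simp
    next
      case 2
      then have "i = Suc (i - 1)" by simp
      then show ?thesis
        using word_eval_map_letter[OF G, of y n "i - 1" m, OF yc per n]
          word_eval_map_letter[OF G, of y n 0 m, OF yc per n] rel[of "i - 1"] 2(1,2) by simp
    qed
  qed
  obtain h where h: "h \<in> hom (presented_group {1..n} (toric_relations k n m)) G"
    and hx: "\<forall>x\<in>{1..n}. h (pres_class {1..n} (toric_relations k n m) [(x, True)]) = ?f x"
    using presented_group_universal[OF G f toric_relations_words[OF n] sat] by blast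
  have "h (toric_gen k n m (Suc j)) = y j" for j
    using hx[rule_format, of "j mod n + 1"] n mod[of j]
    by (simp add: toric_gen_def toric_letter_def Suc_le_eq)
  then show ?thesis using h by (auto simp: toric_group_def)
qed

lemma toric_gen_closed: "n \<ge> 1 \<Longrightarrow> toric_gen k n m i \<in> carrier (toric_group k n m)"
  by (simp add: toric_gen_def toric_group_def carrier_presented_group toric_letter_def Suc_le_eq)

lemma toric_tuple_toric_gen:
  assumes n: "n \<ge> 1"
  shows "toric_tuple (toric_group k n m) k n m (\<lambda>j. toric_gen k n m (Suc j))"
proof -
  let ?S = "{1..n}" and ?R = "toric_relations k n m" and ?W = "toric_group k n m"
  let ?y = "\<lambda>j. toric_gen k n m (Suc j)"
  interpret group ?W by (rule group_toric_group)
  have letter: "fst (toric_letter n j) \<in> {1..n}" for j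
    using n by (simp add: toric_letter_def Suc_le_eq)
  have words: "map (toric_letter n) js \<in> words {1..n}" for js
    by (induction js) (use letter in auto)
  have rwords: "replicate l (toric_letter n j) \<in> words {1..n}" for l j
    by (induction l) (use letter in auto)
  have per: "?y (j + n) = ?y j" for j by (simp add: toric_gen_def toric_letter_def)
  have cp: "consecutive_prod ?W ?y i l = pres_class ?S ?R (map (toric_letter n) [Suc i..<Suc i + l])" for i l
  proof (induction l)
    case (Suc l)
    then show ?case
      using mult_pres_class[of "map (toric_letter n) [Suc i..<Suc i + l]" ?S "[toric_letter n (Suc (i + l))]" ?R]
        words letter by (simp add: toric_gen_def toric_group_def)
  qed (simp add: toric_group_def one_presented_group)
  have pw: "toric_gen k n m i [^]\<^bsub>?W\<^esub> l = pres_class ?S ?R (replicate l (toric_letter n i))" for i l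
  proof (induction l)
    case (Suc l)
    have "replicate l (toric_letter n i) @ [toric_letter n i] = replicate (Suc l) (toric_letter n i)"
      by (simp add: replicate_append_same)
    then show ?case
      using Suc mult_pres_class[of "replicate l (toric_letter n i)" ?S "[toric_letter n i]" ?R] letter rwords
      by (simp add: toric_gen_def toric_group_def)
  qed (simp add: toric_group_def one_presented_group)
  have "?y j [^]\<^bsub>?W\<^esub> k = \<one>\<^bsub>?W\<^esub>" for j
  proof -
    have "toric_letter n (Suc j) = toric_letter n (j mod n + 1)" by (simp add: toric_letter_def)
    moreover have "j mod n + 1 \<in> {1..n}" using n by (simp add: Suc_le_eq)
    ultimately have "(replicate k (toric_letter n (Suc j)), []) \<in> ?R"
      by (auto simp: toric_relations_def)
    then have "pres_cong ?S ?R (replicate k (toric_letter n (Suc j))) []"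
      using rwords by (intro pres_cong.rel) auto
    then show ?thesis
      unfolding pw using pres_class_eq_iff[OF rwords]
      by (simp add: toric_group_def one_presented_group)
  qed
  moreover have "consecutive_prod ?W ?y i m = consecutive_prod ?W ?y 0 m" for i
  proof -
    \<comment> \<open>The presentation states the relation only for the first n starting letters;
      periodicity gives the others.\<close>
    have small: "consecutive_prod ?W ?y i m = consecutive_prod ?W ?y 0 m" if "i < n" for i
    proof (cases "i = 0")
      case False
      with that have "Suc i \<in> {2..n}" by simp
      then have "(map (toric_letter n) [1..<m + 1], map (toric_letter n) [Suc i..<Suc i + m]) \<in> ?R"
        unfolding toric_relations_def by blast
      then have "pres_cong ?S ?R (map (toric_letter n) [1..<m + 1]) (map (toric_letter n) [Suc i..<Suc i + m])"
        using words by (intro pres_cong.rel) auto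
      then show ?thesis
        unfolding cp using pres_class_eq_iff[OF words] pres_cong.sym by (simp del: upt_Suc)
    qed simp
    have "consecutive_prod ?W ?y (i mod n) m = consecutive_prod ?W ?y i m"
      using periodic_mod[of "\<lambda>i. consecutive_prod ?W ?y i m" n] consecutive_prod_shift[of ?y n, OF per]
      by simp
    then show ?thesis using small[of "i mod n"] n by simp
  qed
  ultimately show ?thesis
    unfolding toric_tuple_def using per toric_gen_closed[OF n] by blast
qed

lemma toric_group_generated:
  assumes n: "n \<ge> 1" and H: "subgroup H (toric_group k n m)" and gen: "\<And>j. toric_gen k n m (Suc j) \<in> H"
  shows "H = carrier (toric_group k n m)"
proof -
  let ?S = "{1..n}" and ?R = "toric_relations k n m" and ?W = "toric_group k n m"
  interpret group ?W by (rule group_toric_group)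
  interpret H: subgroup H ?W by (rule H)
  have letter: "pres_class ?S ?R [(x, b)] \<in> H" if "x \<in> ?S" for x b
  proof -
    have pos: "pres_class ?S ?R [(x, True)] \<in> H"
      using gen[of "x - 1"] that by (cases x) (auto simp: toric_gen_def toric_letter_def)
    have "pres_class ?S ?R [(x, False)] \<otimes>\<^bsub>?W\<^esub> pres_class ?S ?R [(x, True)] = \<one>\<^bsub>?W\<^esub>"
      using that pres_cong.cancel[OF that, of ?R False]
      by (simp add: toric_group_def mult_pres_class one_presented_group pres_class_eq_iff)
    moreover have "pres_class ?S ?R [(x, b)] \<in> carrier ?W" for b
      using that by (simp add: toric_group_def carrier_presented_group)
    ultimately have "inv\<^bsub>?W\<^esub> (pres_class ?S ?R [(x, True)]) = pres_class ?S ?R [(x, False)]"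
      by (intro inv_equality) auto
    then show ?thesis using pos H.m_inv_closed[OF pos] by (cases b) auto
  qed
  have "pres_class ?S ?R w \<in> H" if "w \<in> words ?S" for w
    using that
  proof (induction w)
    case Nil
    then show ?case using H.one_closed by (simp add: toric_group_def one_presented_group)
  next
    case (Cons p w)
    then have "pres_class ?S ?R [p] \<otimes>\<^bsub>?W\<^esub> pres_class ?S ?R w \<in> H"
      using letter by (cases p) auto
    then show ?case using Cons.prems by (simp add: toric_group_def mult_pres_class)
  qed
  then show ?thesis
    using H.subset by (auto simp: toric_group_def carrier_presented_group)
qed

section \<open>Matrices and companion matrices\<close>

text \<open>A HOL-Algebra record, so that group homomorphisms and the group inverse apply to
  matrices.\<close>

definition GL :: "nat \<Rightarrow> complex mat monoid" where
  "GL d = \<lparr>carrier = {M \<in> carrier_mat d d. det M \<noteq> 0}, monoid.mult = (*), one = 1\<^sub>m d\<rparr>"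

lemma GL_simps [simp]:
  "M \<in> carrier (GL d) \<longleftrightarrow> M \<in> carrier_mat d d \<and> det M \<noteq> 0"
  "M \<otimes>\<^bsub>GL d\<^esub> N = M * N" "\<one>\<^bsub>GL d\<^esub> = 1\<^sub>m d"
  by (simp_all add: GL_def)

lemma group_GL: "group (GL d)"
proof (rule groupI)
  fix M assume M: "M \<in> carrier (GL d)"
  then have "M \<in> Units (ring_mat TYPE(complex) d ())" by (auto intro: det_non_zero_imp_unit)
  then obtain N where N: "N \<in> carrier_mat d d" "N * M = 1\<^sub>m d"
    by (auto simp: Units_def ring_mat_simps)
  then have "det N * det M = 1" using M by (metis GL_simps(1) det_mult det_one)
  then have "det N \<noteq> 0" by auto
  then show "\<exists>N\<in>carrier (GL d). N \<otimes>\<^bsub>GL d\<^esub> M = \<one>\<^bsub>GL d\<^esub>" using N by auto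
qed (auto simp: det_mult)

lemma GL_pow: "M \<in> carrier_mat d d \<Longrightarrow> M [^]\<^bsub>GL d\<^esub> (j::nat) = M ^\<^sub>m j"
  by (induction j) auto

lemma GL_inv:
  assumes "M \<in> carrier_mat d d" "det M \<noteq> 0"
  shows "inv\<^bsub>GL d\<^esub> M \<in> carrier_mat d d" "inv\<^bsub>GL d\<^esub> M * M = 1\<^sub>m d" "M * inv\<^bsub>GL d\<^esub> M = 1\<^sub>m d"
proof -
  interpret group "GL d" by (rule group_GL)
  show "inv\<^bsub>GL d\<^esub> M \<in> carrier_mat d d" "inv\<^bsub>GL d\<^esub> M * M = 1\<^sub>m d" "M * inv\<^bsub>GL d\<^esub> M = 1\<^sub>m d"
    using inv_closed[of M] l_inv[of M] r_inv[of M] assms by auto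
qed

lemma pow_mat_Suc_left:
  fixes A :: "complex mat"
  assumes A: "A \<in> carrier_mat d d"
  shows "A ^\<^sub>m Suc N = A * A ^\<^sub>m N"
proof (induction N)
  case (Suc N)
  have "A ^\<^sub>m Suc (Suc N) = (A * A ^\<^sub>m N) * A" using Suc by simp
  also have "\<dots> = A * (A ^\<^sub>m N * A)" by (rule assoc_mult_mat[OF A _ A]) (use A in simp)
  finally show ?case by simp
qed (use A in simp)

lemma mat_eq_by_mult_vec:
  fixes A B :: "complex mat"
  assumes A: "A \<in> carrier_mat d d" and B: "B \<in> carrier_mat d d"
    and eq: "\<And>v. v \<in> carrier_vec d \<Longrightarrow> A *\<^sub>v v = B *\<^sub>v v"
  shows "A = B"
proof (rule eq_matI)
  fix i j assume ij: "i < dim_row B" "j < dim_col B"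
  have "(A *\<^sub>v unit_vec d j) $ i = (B *\<^sub>v unit_vec d j) $ i" using eq by simp
  then show "A $$ (i, j) = B $$ (i, j)" using A B ij by simp
qed (use A B in auto)

lemma smult_mat_mult_vec:
  fixes A :: "complex mat"
  assumes "A \<in> carrier_mat d d" "v \<in> carrier_vec d"
  shows "(z \<cdot>\<^sub>m A) *\<^sub>v v = z \<cdot>\<^sub>v (A *\<^sub>v v)"
  using assms by (intro eq_vecI) auto

lemma det_nonzeroI:
  fixes M :: "complex mat"
  assumes "M \<in> carrier_mat d d" and "\<And>v. v \<in> carrier_vec d \<Longrightarrow> M *\<^sub>v v = 0\<^sub>v d \<Longrightarrow> v = 0\<^sub>v d"
  shows "det M \<noteq> 0"
  using assms det_0_iff_vec_prod_zero_field[OF assms(1)] by blast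

lemma common_kernel:
  fixes f :: "nat \<Rightarrow> complex vec"
  assumes "\<And>j. f j \<in> carrier_vec d" and nd: "n < d"
  shows "\<exists>v\<in>carrier_vec d. v \<noteq> 0\<^sub>v d \<and> (\<forall>j<n. f j \<bullet> v = 0)"
proof -
  \<comment> \<open>The n forms become rows of a square matrix padded with zero rows. Its last row
    is zero because n < d, so it is singular.\<close>
  define M where "M = mat d d (\<lambda>(i, j). if i < n then f i $ j else 0)"
  have M: "M \<in> carrier_mat d d" by (simp add: M_def)
  have "M\<^sup>T *\<^sub>v unit_vec d (d - 1) = 0\<^sub>v d"
    using nd by (intro eq_vecI) (auto simp: M_def)
  moreover have "unit_vec d (d - 1) \<noteq> (0\<^sub>v d :: complex vec)" using nd by simp
  ultimately have "det M\<^sup>T = 0"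
    using M det_0_iff_vec_prod_zero_field[of "M\<^sup>T" d] unit_vec_carrier by (metis transpose_carrier_mat)
  then have "det M = 0" using det_transpose[OF M] by simp
  then obtain v where v: "v \<in> carrier_vec d" "v \<noteq> 0\<^sub>v d" "M *\<^sub>v v = 0\<^sub>v d"
    using det_0_iff_vec_prod_zero_field[OF M] by blast
  have "f j \<bullet> v = 0" if "j < n" for j
  proof -
    have "row M j = f j" using that nd assms(1)[of j] by (intro eq_vecI) (auto simp: M_def)
    then have "(M *\<^sub>v v) $ j = f j \<bullet> v" using M that nd by simp
    then show ?thesis using v that nd by simp
  qed
  then show ?thesis using v by blast
qed

section \<open>Maps that fix a hyperplane pointwise\<close>

definition fixes_hyperplane :: "nat \<Rightarrow> complex mat \<Rightarrow> bool" where
  "fixes_hyperplane d M \<longleftrightarrow>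
     (\<exists>f\<in>carrier_vec d. \<forall>v\<in>carrier_vec d. f \<bullet> v = 0 \<longrightarrow> M *\<^sub>v v = v)"

text \<open>The form in \<open>fixes_hyperplane\<close> may be zero, which describes exactly the
  identity. This case has to count, since a reflection may act trivially in a
  representation.\<close>

lemma fixes_hyperplane_one: "fixes_hyperplane d (1\<^sub>m d)"
  unfolding fixes_hyperplane_def by (rule bexI[of _ "0\<^sub>v d"]) auto

lemma fixes_hyperplane_int_pow:
  assumes M: "M \<in> carrier (GL d)" and h: "fixes_hyperplane d M"
  shows "fixes_hyperplane d (M [^]\<^bsub>GL d\<^esub> (l::int))"
proof -
  interpret group "GL d" by (rule group_GL)
  obtain f where f: "f \<in> carrier_vec d" and fix_M: "\<And>v. v \<in> carrier_vec d \<Longrightarrow> f \<bullet> v = 0 \<Longrightarrow> M *\<^sub>v v = v"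
    using h by (auto simp: fixes_hyperplane_def)
  have pow: "(M [^]\<^bsub>GL d\<^esub> j) *\<^sub>v v = v" if "v \<in> carrier_vec d" "f \<bullet> v = 0" for v and j :: nat
  proof (induction j)
    case (Suc j)
    have "M [^]\<^bsub>GL d\<^esub> j \<in> carrier_mat d d" using M nat_pow_closed[of M j] by simp
    then show ?case
      using Suc M that fix_M by (simp add: assoc_mult_mat_vec[of _ d d _ d])
  qed (use that in auto)
  have inv: "(inv\<^bsub>GL d\<^esub> (M [^]\<^bsub>GL d\<^esub> j)) *\<^sub>v v = v" if "v \<in> carrier_vec d" "f \<bullet> v = 0" for v and j :: nat
  proof -
    let ?N = "M [^]\<^bsub>GL d\<^esub> j"
    have N: "?N \<in> carrier_mat d d" "det ?N \<noteq> 0" using M nat_pow_closed[of M j] by auto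
    have "inv\<^bsub>GL d\<^esub> ?N *\<^sub>v v = inv\<^bsub>GL d\<^esub> ?N *\<^sub>v (?N *\<^sub>v v)" using pow that by simp
    also have "\<dots> = (inv\<^bsub>GL d\<^esub> ?N * ?N) *\<^sub>v v"
      using assoc_mult_mat_vec[OF GL_inv(1)[OF N] N(1) that(1)] by simp
    also have "\<dots> = v" using GL_inv[OF N] that by simp
    finally show ?thesis .
  qed
  show ?thesis
    unfolding fixes_hyperplane_def
    using f pow inv by (intro bexI[of _ f]) (auto simp: int_pow_def2 simp del: pow_nat)
qed

lemma fixes_hyperplane_conj:
  assumes N: "N \<in> carrier (GL d)" and M: "M \<in> carrier_mat d d" and h: "fixes_hyperplane d M"
  shows "fixes_hyperplane d (N * M * inv\<^bsub>GL d\<^esub> N)"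
proof -
  obtain f where f: "f \<in> carrier_vec d" and fix_M: "\<And>v. v \<in> carrier_vec d \<Longrightarrow> f \<bullet> v = 0 \<Longrightarrow> M *\<^sub>v v = v"
    using h by (auto simp: fixes_hyperplane_def)
  let ?N' = "inv\<^bsub>GL d\<^esub> N"
  have N': "?N' \<in> carrier_mat d d" "N * ?N' = 1\<^sub>m d" and Nc: "N \<in> carrier_mat d d"
    using GL_inv[of N d] N by auto
  have "N * M * ?N' *\<^sub>v v = v" if v: "v \<in> carrier_vec d" "(?N'\<^sup>T *\<^sub>v f) \<bullet> v = 0" for v
  proof -
    have "f \<bullet> (?N' *\<^sub>v v) = 0"
      using transpose_vec_mult_scalar[OF N'(1) v(1) f] v(2) by simp
    then have "M *\<^sub>v (?N' *\<^sub>v v) = ?N' *\<^sub>v v" using fix_M N' v by simp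
    then have "N * M * ?N' *\<^sub>v v = (N * ?N') *\<^sub>v v"
      using Nc M N'(1) v(1) by (simp add: assoc_mult_mat_vec[of _ d d _ d] mult_carrier_mat[of _ d d _ d])
    then show ?thesis using N'(2) v(1) by simp
  qed
  then show ?thesis
    unfolding fixes_hyperplane_def using f N' by (intro bexI[of _ "?N'\<^sup>T *\<^sub>v f"]) auto
qed

text \<open>M - 1 vanishes on the hyperplane and so has rank at most one: it is e f^T, where e is
  the image under M - 1 of a vector u with f u = 1.\<close>

lemma hyperplane_form:
  assumes M: "M \<in> carrier_mat d d" and h: "fixes_hyperplane d M"
  shows "\<exists>e\<in>carrier_vec d. \<exists>f\<in>carrier_vec d. \<forall>v\<in>carrier_vec d. M *\<^sub>v v = v + (f \<bullet> v) \<cdot>\<^sub>v e"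
proof -
  obtain f where f: "f \<in> carrier_vec d" and fix_M: "\<And>v. v \<in> carrier_vec d \<Longrightarrow> f \<bullet> v = 0 \<Longrightarrow> M *\<^sub>v v = v"
    using h by (auto simp: fixes_hyperplane_def)
  show ?thesis
  proof (cases "f = 0\<^sub>v d")
    case True
    then have "M *\<^sub>v v = v + (f \<bullet> v) \<cdot>\<^sub>v 0\<^sub>v d" if "v \<in> carrier_vec d" for v
      using fix_M[OF that] that by (intro eq_vecI) auto
    then show ?thesis using f by (intro bexI[of _ "0\<^sub>v d"] bexI[of _ f]) auto
  next
    case False
    then obtain i where i: "i < d" "f $ i \<noteq> 0" using f by (auto simp: vec_eq_iff)
    define u where "u = (1 / f $ i) \<cdot>\<^sub>v unit_vec d i"
    have u: "u \<in> carrier_vec d" "f \<bullet> u = 1"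
      using i f scalar_prod_right_unit[of i d f] by (auto simp: u_def)
    define e where "e = M *\<^sub>v u - u"
    have e: "e \<in> carrier_vec d" using u M by (auto simp: e_def)
    have "M *\<^sub>v v = v + (f \<bullet> v) \<cdot>\<^sub>v e" if v: "v \<in> carrier_vec d" for v
    proof -
      define w where "w = v - (f \<bullet> v) \<cdot>\<^sub>v u"
      have w: "w \<in> carrier_vec d" "f \<bullet> w = 0"
        using u v f by (auto simp: w_def scalar_prod_minus_distrib[of f d])
      have "M *\<^sub>v w = M *\<^sub>v v - (f \<bullet> v) \<cdot>\<^sub>v (M *\<^sub>v u)"
        using u v M by (simp add: w_def mult_minus_distrib_mat_vec[of M d d] mult_mat_vec[of M d d])
      then have "M *\<^sub>v v - (f \<bullet> v) \<cdot>\<^sub>v (M *\<^sub>v u) = v - (f \<bullet> v) \<cdot>\<^sub>v u"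
        using fix_M[OF w] by (simp add: w_def)
      then have "(M *\<^sub>v v - (f \<bullet> v) \<cdot>\<^sub>v (M *\<^sub>v u)) $ i = (v - (f \<bullet> v) \<cdot>\<^sub>v u) $ i" for i by simp
      then have "(M *\<^sub>v v) $ i - (f \<bullet> v) * (M *\<^sub>v u) $ i = v $ i - (f \<bullet> v) * u $ i" if "i < d" for i
        using that u v M by (metis carrier_matD(1) carrier_vecD dim_mult_mat_vec index_minus_vec(1) index_smult_vec)
      then show ?thesis
        using u v M by (intro eq_vecI) (auto simp: e_def algebra_simps simp del: index_mult_mat_vec)
    qed
    then show ?thesis using e f by blast
  qed
qed

section \<open>Companion matrices and their action on polynomials\<close>

definition companion :: "nat \<Rightarrow> (nat \<Rightarrow> complex) \<Rightarrow> complex mat" where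
  "companion d c = mat d d (\<lambda>(i, j). if j = 0 then c i else if j = Suc i then 1 else 0)"

definition companion_poly :: "nat \<Rightarrow> (nat \<Rightarrow> complex) \<Rightarrow> complex poly" where
  "companion_poly d c = monom 1 d - (\<Sum>i<d. monom (c i) (d - 1 - i))"

text \<open>Entries are coefficients from degree d - 1 downwards. Entry 0 is the one that reaches
  degree d after multiplication by the variable, which is why \<open>companion\<close> has its
  coefficients in the first column.\<close>

definition vec_poly :: "nat \<Rightarrow> complex vec \<Rightarrow> complex poly" where
  "vec_poly d v = (\<Sum>i<d. monom (v $ i) (d - 1 - i))"

lemma companion_carrier [simp]: "companion d c \<in> carrier_mat d d"
  by (simp add: companion_def)

lemma companion_mult_vec:
  assumes v: "v \<in> carrier_vec d" and i: "i < d"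
  shows "(companion d c *\<^sub>v v) $ i = c i * v $ 0 + (if Suc i < d then v $ Suc i else 0)"
proof -
  have "(companion d c *\<^sub>v v) $ i =
      (\<Sum>j\<in>{0..<d}. (if j = 0 then c i * v $ 0 else 0) + (if j = Suc i then v $ Suc i else 0))"
  proof -
    have "(companion d c *\<^sub>v v) $ i = (\<Sum>j\<in>{0..<d}. companion d c $$ (i, j) * v $ j)"
      using v i by (simp add: companion_def scalar_prod_def)
    also have "\<dots> = (\<Sum>j\<in>{0..<d}. (if j = 0 then c i * v $ 0 else 0) + (if j = Suc i then v $ Suc i else 0))"
      using i by (intro sum.cong) (auto simp: companion_def)
    finally show ?thesis .
  qed
  also have "\<dots> = c i * v $ 0 + (if Suc i < d then v $ Suc i else 0)"
    using i by (simp add: sum.distrib)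
  finally show ?thesis .
qed

lemma coeff_reversed_sum:
  "coeff (\<Sum>i<d. monom (a i) (d - 1 - i)) j = (if j < d then a (d - 1 - j) else (0::complex))"
proof -
  have "coeff (\<Sum>i<d. monom (a i) (d - 1 - i)) j = (\<Sum>i<d. if i = d - 1 - j \<and> j < d then a i else 0)"
    unfolding coeff_sum by (rule sum.cong) auto
  then show ?thesis by (auto simp: sum.delta)
qed

lemma coeff_vec_poly: "coeff (vec_poly d v) j = (if j < d then v $ (d - 1 - j) else 0)"
  unfolding vec_poly_def by (rule coeff_reversed_sum)

lemma coeff_companion_poly:
  "coeff (companion_poly d c) j = (if j = d then 1 else if j < d then - c (d - 1 - j) else 0)"
  unfolding companion_poly_def coeff_diff coeff_reversed_sum by simp

lemma companion_poly_monic: "degree (companion_poly d c) = d" "lead_coeff (companion_poly d c) = 1"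
proof -
  show "degree (companion_poly d c) = d"
    by (rule antisym; rule degree_le le_degree) (auto simp: coeff_companion_poly)
  then show "lead_coeff (companion_poly d c) = 1" by (simp add: coeff_companion_poly)
qed

lemma companion_poly_nonzero: "companion_poly d c \<noteq> 0"
  using companion_poly_monic(2)[of d c] by auto

lemma vec_poly_inj:
  assumes v: "v \<in> carrier_vec d" and w: "w \<in> carrier_vec d" and eq: "vec_poly d v = vec_poly d w"
  shows "v = w"
proof (rule eq_vecI)
  fix i assume "i < dim_vec w"
  then have i: "i < d" using w by simp
  have "coeff (vec_poly d v) (d - 1 - i) = coeff (vec_poly d w) (d - 1 - i)" using eq by simp
  then show "v $ i = w $ i" using i by (simp add: coeff_vec_poly split: if_splits)
qed (use v w in auto)

lemma vec_poly_smult: "v \<in> carrier_vec d \<Longrightarrow> vec_poly d (z \<cdot>\<^sub>v v) = Polynomial.smult z (vec_poly d v)"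
  by (rule poly_eqI) (simp add: coeff_vec_poly)

lemma vec_poly_surj:
  assumes "\<And>j. j \<ge> d \<Longrightarrow> coeff h j = 0"
  shows "vec_poly d (vec d (\<lambda>i. coeff h (d - 1 - i))) = h"
  by (rule poly_eqI) (use assms in \<open>auto simp: coeff_vec_poly\<close>)

text \<open>The companion matrix is multiplication by the variable modulo its polynomial.\<close>

lemma vec_poly_companion:
  assumes v: "v \<in> carrier_vec d" and d: "d \<ge> 1"
  shows "vec_poly d (companion d c *\<^sub>v v) = monom 1 1 * vec_poly d v - Polynomial.smult (v $ 0) (companion_poly d c)"
proof (rule poly_eqI)
  fix j
  show "coeff (vec_poly d (companion d c *\<^sub>v v)) j =
      coeff (monom 1 1 * vec_poly d v - Polynomial.smult (v $ 0) (companion_poly d c)) j"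
  proof (cases j)
    case 0
    then show ?thesis
      using d companion_mult_vec[OF v, of "d - 1" c]
      by (simp add: coeff_vec_poly coeff_companion_poly coeff_monom_mult del: index_mult_mat_vec)
  next
    case (Suc i)
    then show ?thesis
      using d companion_mult_vec[OF v, of "d - 1 - j" c]
      by (auto simp: coeff_vec_poly coeff_companion_poly coeff_monom_mult Suc_diff_Suc
          simp del: index_mult_mat_vec)
  qed
qed

lemma companion_poly_dvd_vec_poly:
  assumes v: "v \<in> carrier_vec d" and d: "d \<ge> 1"
  shows "companion_poly d c dvd vec_poly d ((companion d c ^\<^sub>m N) *\<^sub>v v) - monom 1 N * vec_poly d v"
proof (induction N)
  case (Suc N)
  let ?K = "companion d c" and ?Q = "companion_poly d c"
  let ?w = "?K ^\<^sub>m N *\<^sub>v v"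
  have K: "?K \<in> carrier_mat d d" "?K ^\<^sub>m N \<in> carrier_mat d d" by simp_all
  have w: "?w \<in> carrier_vec d" by (rule mult_mat_vec_carrier[OF K(2) v])
  have "?K ^\<^sub>m Suc N *\<^sub>v v = ?K *\<^sub>v ?w"
  proof -
    have "?K ^\<^sub>m Suc N = ?K * ?K ^\<^sub>m N" by (rule pow_mat_Suc_left[OF K(1)])
    then show ?thesis using assoc_mult_mat_vec[OF K v] by simp
  qed
  moreover have monom_Suc: "monom 1 (Suc N) = monom 1 1 * (monom 1 N :: complex poly)"
    by (simp add: mult_monom)
  ultimately have "vec_poly d (?K ^\<^sub>m Suc N *\<^sub>v v) - monom 1 (Suc N) * vec_poly d v =
      monom 1 1 * (vec_poly d ?w - monom 1 N * vec_poly d v) - Polynomial.smult (?w $ 0) ?Q"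
    by (simp only: monom_Suc right_diff_distrib mult.assoc
        vec_poly_companion[OF w d] diff_diff_eq add.commute)
  then show ?case using Suc by (simp add: dvd_smult dvd_diff)
qed (use v in \<open>simp add: carrier_matD(1)[OF companion_carrier]\<close>)

text \<open>The N-th power acts as multiplication by X^N modulo the companion polynomial. Applying
  it to the polynomial 1 gives one direction; in the other, a multiple of a polynomial of degree d
  that has degree less than d is zero.\<close>

lemma companion_pow_scalar:
  assumes d: "d \<ge> 1"
  shows "companion d c ^\<^sub>m N = \<kappa> \<cdot>\<^sub>m 1\<^sub>m d \<longleftrightarrow> companion_poly d c dvd monom 1 N - [:\<kappa>:]"
proof
  let ?K = "companion d c" and ?Q = "companion_poly d c"
  assume eq: "?K ^\<^sub>m N = \<kappa> \<cdot>\<^sub>m 1\<^sub>m d"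
  define v :: "complex vec" where "v = vec d (\<lambda>i. coeff 1 (d - 1 - i))"
  have v: "v \<in> carrier_vec d" and 1: "vec_poly d v = 1"
    using vec_poly_surj[of d "1 :: complex poly"] d by (auto simp: v_def)
  have "?K ^\<^sub>m N *\<^sub>v v = \<kappa> \<cdot>\<^sub>v v" using v by (simp add: eq smult_mat_mult_vec[of _ d])
  then have "?Q dvd Polynomial.smult \<kappa> 1 - monom 1 N"
    using companion_poly_dvd_vec_poly[OF v d, of c N] v by (simp add: vec_poly_smult 1)
  then show "?Q dvd monom 1 N - [:\<kappa>:]"
    by (metis dvd_diff_commute smult_one)
next
  let ?K = "companion d c" and ?Q = "companion_poly d c"
  assume dvd: "?Q dvd monom 1 N - [:\<kappa>:]"
  show "?K ^\<^sub>m N = \<kappa> \<cdot>\<^sub>m 1\<^sub>m d"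
  proof (rule mat_eq_by_mult_vec[of _ d])
    fix v :: "complex vec" assume v: "v \<in> carrier_vec d"
    let ?w = "?K ^\<^sub>m N *\<^sub>v v"
    have w: "?w \<in> carrier_vec d" by (rule mult_mat_vec_carrier[of _ _ d]) (use v in auto)
    have "?Q dvd (vec_poly d ?w - monom 1 N * vec_poly d v) + (monom 1 N - [:\<kappa>:]) * vec_poly d v"
      using companion_poly_dvd_vec_poly[OF v d, of c N] dvd by (intro dvd_add) auto
    also have "\<dots> = vec_poly d ?w - vec_poly d (\<kappa> \<cdot>\<^sub>v v)"
      using v by (simp add: vec_poly_smult algebra_simps)
    finally have *: "?Q dvd vec_poly d ?w - vec_poly d (\<kappa> \<cdot>\<^sub>v v)" .
    have "vec_poly d ?w - vec_poly d (\<kappa> \<cdot>\<^sub>v v) = 0"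
    proof (rule ccontr)
      assume ne: "vec_poly d ?w - vec_poly d (\<kappa> \<cdot>\<^sub>v v) \<noteq> 0"
      have "coeff (vec_poly d ?w - vec_poly d (\<kappa> \<cdot>\<^sub>v v)) j = 0" if "j \<ge> d" for j
        using that by (simp add: coeff_vec_poly)
      then have "degree (vec_poly d ?w - vec_poly d (\<kappa> \<cdot>\<^sub>v v)) < d"
        using ne by (metis leading_coeff_0_iff not_le)
      then show False using dvd_imp_degree_le[OF * ne] companion_poly_monic(1)[of d c] by simp
    qed
    then have "?w = \<kappa> \<cdot>\<^sub>v v" using v w by (intro vec_poly_inj[of _ d]) auto
    then show "?K ^\<^sub>m N *\<^sub>v v = (\<kappa> \<cdot>\<^sub>m 1\<^sub>m d) *\<^sub>v v" using v by (simp add: smult_mat_mult_vec[of _ d])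
  qed auto
qed

text \<open>With Q the companion polynomial, an eigenvector v for b satisfies v_0 Q = (X - b) v as
  polynomials, and v_0 = 0 would force v = 0. Conversely Q / (X - b) is an eigenvector whose entry 0
  is 1.\<close>

lemma spectrum_companion:
  assumes d: "d \<ge> 1"
  shows "spectrum (companion d c) = {b. poly (companion_poly d c) b = 0}"
proof (intro Set.set_eqI iffI)
  let ?K = "companion d c" and ?Q = "companion_poly d c"
  fix b
  {
    assume "b \<in> spectrum ?K"
    then obtain v where v: "v \<in> carrier_vec d" "v \<noteq> 0\<^sub>v d" "?K *\<^sub>v v = b \<cdot>\<^sub>v v"
      by (auto simp: spectrum_def eigenvalue_def eigenvector_def companion_def)
    then have eq: "Polynomial.smult (v $ 0) ?Q = (monom 1 1 - [:b:]) * vec_poly d v"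
      using vec_poly_companion[OF v(1) d, of c] by (simp add: vec_poly_smult algebra_simps)
    have "v $ 0 \<noteq> 0"
    proof
      assume "v $ 0 = 0"
      moreover have "monom 1 1 - [:b:] \<noteq> 0" by (simp add: monom_altdef)
      ultimately have "vec_poly d v = vec_poly d (0 \<cdot>\<^sub>v v)"
        using eq v by (simp add: vec_poly_smult)
      then have "v = 0 \<cdot>\<^sub>v v" using v by (intro vec_poly_inj[of _ d]) auto
      also have "0 \<cdot>\<^sub>v v = 0\<^sub>v d" using v by (intro eq_vecI) auto
      finally show False using v by simp
    qed
    moreover have "poly (Polynomial.smult (v $ 0) ?Q) b = 0" unfolding eq by (simp add: poly_monom)
    ultimately show "b \<in> {b. poly ?Q b = 0}" by simp
  next
    assume "b \<in> {b. poly ?Q b = 0}"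
    then obtain h where h: "?Q = [:- b, 1:] * h" by (auto simp: poly_eq_0_iff_dvd elim: dvdE)
    have h0: "h \<noteq> 0" using h companion_poly_nonzero[of d c] by auto
    then have deg: "Suc (degree h) = d"
      using companion_poly_monic(1)[of d c] unfolding h by (subst (asm) degree_mult_eq) auto
    have lead: "coeff h (d - 1) = 1"
      using companion_poly_monic(2)[of d c] deg unfolding h lead_coeff_mult by auto
    define v where "v = vec d (\<lambda>i. coeff h (d - 1 - i))"
    have v: "v \<in> carrier_vec d" and hv: "vec_poly d v = h"
      using vec_poly_surj[of d h] deg by (auto simp: v_def coeff_eq_0)
    have v0: "v $ 0 = 1" using d lead by (simp add: v_def)
    have "vec_poly d (?K *\<^sub>v v) = vec_poly d (b \<cdot>\<^sub>v v)"
      unfolding vec_poly_companion[OF v d] vec_poly_smult[OF v] hv v0 h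
      by (simp add: monom_altdef algebra_simps)
    moreover have "?K *\<^sub>v v \<in> carrier_vec d" by (rule mult_mat_vec_carrier[OF companion_carrier v])
    ultimately have "?K *\<^sub>v v = b \<cdot>\<^sub>v v" using v by (intro vec_poly_inj[of _ d]) auto
    moreover have "v \<noteq> 0\<^sub>v d" using v0 d by auto
    ultimately show "b \<in> spectrum ?K"
      using v by (auto simp: spectrum_def eigenvalue_def eigenvector_def companion_def)
  }
qed

lemma spectrum_conj:
  fixes M N P :: "complex mat"
  assumes M: "M \<in> carrier_mat d d" and N: "N \<in> carrier_mat d d" and P: "P \<in> carrier_mat d d" "det P \<noteq> 0"
    and eq: "P * M = N * P"
  shows "spectrum M = spectrum N"
proof -
  let ?P' = "inv\<^bsub>GL d\<^esub> P"
  note P' = GL_inv[OF P]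
  have "N = N * (P * ?P')" using N P' by simp
  also have "\<dots> = (N * P) * ?P'" using N P P' by simp
  also have "\<dots> = P * M * ?P'" by (simp add: eq)
  finally have "similar_mat N M"
    using M N P P' by (intro similar_matI[of _ _ P ?P' d]) auto
  then show ?thesis
    using char_poly_similar spectrum_root_char_poly[OF M] spectrum_root_char_poly[OF N] by metis
qed

section \<open>Normal form of a reflection representation\<close>

lemma rsquarefree_binomial:
  assumes "\<kappa> \<noteq> 0" "m \<ge> 1"
  shows "rsquarefree (monom 1 m - [:\<kappa>:] :: complex poly)"
  unfolding rsquarefree_roots
  using assms by (auto simp: pderiv_diff pderiv_monom pderiv_pCons poly_monom power_0_left)

text \<open>A divisor of a polynomial with simple roots has simple roots; a monic one is therefore
  recovered from its set of roots.\<close>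

lemma roots_of_dvd_binomial:
  fixes Q :: "complex poly"
  assumes dvd: "Q dvd monom 1 m - [:\<kappa>:]" and \<kappa>: "\<kappa> \<noteq> 0" and m: "m \<ge> 1" and lead: "lead_coeff Q = 1"
  defines "S \<equiv> {z. poly Q z = 0}"
  shows "S \<subseteq> {z. z ^ m = \<kappa>}" "card S = degree Q" "Q = (\<Prod>b\<in>S. [:- b, 1:])"
proof -
  obtain D where D: "monom 1 m - [:\<kappa>:] = Q * D" using dvd by (auto elim: dvdE)
  have "\<not> (poly Q a = 0 \<and> poly (pderiv Q) a = 0)" for a
  proof
    assume "poly Q a = 0 \<and> poly (pderiv Q) a = 0"
    then have "poly (Q * D) a = 0 \<and> poly (pderiv (Q * D)) a = 0" by (simp add: pderiv_mult)
    then show False using rsquarefree_binomial[OF \<kappa> m] unfolding D[symmetric] rsquarefree_roots by blast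
  qed
  then have "rsquarefree Q" by (simp add: rsquarefree_roots)
  then show Q: "Q = (\<Prod>b\<in>S. [:- b, 1:])"
    using complex_poly_decompose_rsquarefree[of Q] lead by (simp add: S_def)
  show "card S = degree Q" by (subst Q) (simp add: degree_prod_eq_sum_degree)
  have "poly (monom 1 m - [:\<kappa>:]) z = 0" if "poly Q z = 0" for z unfolding D using that by simp
  then show "S \<subseteq> {z. z ^ m = \<kappa>}" by (auto simp: S_def poly_monom)
qed

lemma prod_linear_dvd_binomial:
  assumes S: "S \<subseteq> {z::complex. z ^ m = \<kappa>}" and \<kappa>: "\<kappa> \<noteq> 0" and m: "m \<ge> 1"
  shows "(\<Prod>b\<in>S. [:- b, 1:]) dvd monom 1 m - [:\<kappa>:]"
proof -
  let ?E = "{z. poly (monom 1 m - [:\<kappa>:]) z = 0}"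
  have E: "?E = {z. z ^ m = \<kappa>}" by (auto simp: poly_monom)
  have "monom 1 m - [:\<kappa>:] \<noteq> 0" using rsquarefree_binomial[OF \<kappa> m] by (auto simp: rsquarefree_def)
  then have fin: "finite ?E" by (rule poly_roots_finite)
  have "(\<Prod>b\<in>S. [:- b, 1:]) dvd (\<Prod>b\<in>?E. [:- b, 1:])"
    by (rule prod_dvd_prod_subset) (use S E fin in auto)
  also have "\<dots> dvd monom 1 m - [:\<kappa>:]"
    using complex_poly_decompose_rsquarefree[OF rsquarefree_binomial[OF \<kappa> m]]
    by (metis dvd_smult dvd_refl)
  finally show ?thesis .
qed

text \<open>Expressing both conditions by powers of one number makes them compatible: the product of
  n such roots always has m-th power \<theta>^(n m), so the condition selects one m-th root of this
  number.\<close>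

definition root_sets :: "nat \<Rightarrow> nat \<Rightarrow> complex \<Rightarrow> complex set set" where
  "root_sets n m \<theta> = {S. S \<subseteq> {z. z ^ m = \<theta> ^ m} \<and> card S = n \<and> \<Prod>S = \<theta> ^ n}"

text \<open>Multiplication by \<open>m\<close>-th roots of unity acts freely on the \<open>n\<close>-subsets of
  \<open>{z. z ^ m = \<theta> ^ m}\<close>, and since \<open>n\<close> is coprime to \<open>m\<close> every orbit contains exactly one
  set with product \<open>\<theta> ^ n\<close>.\<close>

lemma card_root_sets:
  fixes n m s t :: nat
  assumes st: "n * t = m * s + 1" and \<theta>: "\<theta> \<noteq> 0" and m: "m \<ge> 1"
  shows "finite (root_sets n m \<theta>)" "m * card (root_sets n m \<theta>) = m choose n"
proof -
  let ?E = "{z. z ^ m = \<theta> ^ m}" and ?U = "{z::complex. z ^ m = 1}"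
  have E: "finite ?E" "card ?E = m" using card_nth_roots[of "\<theta> ^ m" m] \<theta> m
    by (auto intro: card_ge_0_finite)
  have U: "card ?U = m" using card_roots_unity_eq[of m] m by simp
  show fin: "finite (root_sets n m \<theta>)"
    by (rule finite_subset[of _ "Pow ?E"]) (use E in \<open>auto simp: root_sets_def\<close>)
  \<comment> \<open>The exponent 1 is the combination n t - m s of n and m.\<close>
  have root_one: "z = 1" if "z ^ n = 1" "z ^ m = 1" for z :: complex
  proof -
    have "z ^ (m * s + 1) = z ^ (n * t)" by (simp add: st)
    then show ?thesis using that by (simp add: power_mult)
  qed
  have prod_image: "\<Prod>((*) u ` S) = u ^ card S * \<Prod>S" if "u \<noteq> 0" for u :: complex and S
  proof -
    have "inj_on ((*) u) S" using that by (auto simp: inj_on_def)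
    then have "\<Prod>((*) u ` S) = (\<Prod>x\<in>S. u * x)" by (simp add: prod.reindex)
    then show ?thesis by (simp add: prod.distrib)
  qed
  have card_image: "card ((*) u ` S) = card S" if "u \<noteq> 0" for u :: complex and S
    using that by (intro card_image) (auto simp: inj_on_def)
  have Unz: "u \<noteq> 0" if "u \<in> ?U" for u using that m by (auto simp: power_0_left)
  have "bij_betw (\<lambda>(u, S). (*) u ` S) (?U \<times> root_sets n m \<theta>) {S. S \<subseteq> ?E \<and> card S = n}"
    unfolding bij_betw_def
  proof
    show "inj_on (\<lambda>(u, S). (*) u ` S) (?U \<times> root_sets n m \<theta>)"
    proof (rule inj_onI, clarify)
      fix u S v T
      assume u: "u ^ m = 1" and v: "v ^ m = 1" and S: "S \<in> root_sets n m \<theta>" and T: "T \<in> root_sets n m \<theta>"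
        and eq: "(*) u ` S = (*) v ` T"
      have nz: "u \<noteq> 0" "v \<noteq> 0" using Unz u v by auto
      have "u ^ n * \<theta> ^ n = v ^ n * \<theta> ^ n"
        using prod_image[OF nz(1), of S] prod_image[OF nz(2), of T] S T eq by (auto simp: root_sets_def)
      then have "(u / v) ^ n = 1" using \<theta> nz by (simp add: power_divide)
      moreover have "(u / v) ^ m = 1" using u v by (simp add: power_divide)
      ultimately have "u / v = 1" by (rule root_one)
      then have "u = v" using nz by simp
      moreover have "S = T" using eq nz unfolding \<open>u = v\<close> by (auto simp: inj_image_eq_iff inj_def)
      ultimately show "u = v \<and> S = T" ..
    qed
    show "(\<lambda>(u, S). (*) u ` S) ` (?U \<times> root_sets n m \<theta>) = {S. S \<subseteq> ?E \<and> card S = n}"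
    proof
      show "(\<lambda>(u, S). (*) u ` S) ` (?U \<times> root_sets n m \<theta>) \<subseteq> {S. S \<subseteq> ?E \<and> card S = n}"
        using card_image Unz by (auto simp: root_sets_def power_mult_distrib)
      show "{S. S \<subseteq> ?E \<and> card S = n} \<subseteq> (\<lambda>(u, S). (*) u ` S) ` (?U \<times> root_sets n m \<theta>)"
      proof clarify
        fix T assume T: "T \<subseteq> ?E" and n: "n = card T"
        define r where "r = \<Prod>T / \<theta> ^ n"
        have "(\<Prod>T) ^ m = (\<Prod>z\<in>T. z ^ m)" by (simp add: prod_power_distrib)
        also have "\<dots> = (\<Prod>z\<in>T. \<theta> ^ m)" using T by (intro prod.cong) auto
        also have "\<dots> = (\<theta> ^ n) ^ m" by (simp add: n flip: power_mult) (simp add: mult.commute)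
        finally have "r ^ m = 1" using \<theta> by (simp add: r_def power_divide)
        \<comment> \<open>On m-th roots of unity the power n is inverted by the power t, as n t is 1
          modulo m. Dividing the elements of \<open>T\<close> by this n-th root of \<open>r\<close>
          corrects its product.\<close>
        define u where "u = r ^ t"
        have um: "u ^ m = 1" using \<open>r ^ m = 1\<close> by (simp add: u_def mult.commute flip: power_mult) (simp add: power_mult)
        have "u ^ n = r ^ (n * t)" by (simp add: u_def mult.commute flip: power_mult)
        also have "\<dots> = r" using \<open>r ^ m = 1\<close> unfolding st by (simp add: power_mult)
        finally have un: "u ^ n = r" .
        have nz: "u \<noteq> 0" using Unz um by auto
        define S where "S = (*) (inverse u) ` T"
        have *: "u * (inverse u * x) = x" for x using nz by (simp flip: mult.assoc)
        have "T = (*) u ` S" unfolding S_def image_image * by simp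
        moreover have "S \<in> root_sets n m \<theta>"
        proof -
          have "r \<noteq> 0" using un nz by auto
          have "\<Prod>S = inverse (u ^ n) * \<Prod>T"
            using prod_image[of "inverse u" T] nz by (simp add: S_def n power_inverse)
          also have "\<dots> = \<theta> ^ n" unfolding un using \<open>r \<noteq> 0\<close> \<theta> by (auto simp: r_def field_simps)
          finally have "\<Prod>S = \<theta> ^ n" .
          moreover have "S \<subseteq> ?E" using T um by (auto simp: S_def power_mult_distrib power_inverse)
          moreover have "card S = n" using card_image[of "inverse u" T] nz by (simp add: S_def n)
          ultimately show ?thesis by (simp add: root_sets_def)
        qed
        ultimately show "T \<in> (\<lambda>(u, S). (*) u ` S) ` (?U \<times> root_sets (card T) m \<theta>)"
          using um n by force
      qed
    qed
  qed
  from bij_betw_same_card[OF this] show "m * card (root_sets n m \<theta>) = m choose n"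
    using n_subsets[OF E(1), of n] E(2) U by (simp add: card_cartesian_product)
qed

text \<open>By absorption, binomial(m,n) / m = binomial(m-1,n-1) / n, which increases strictly with
  m once n >= 2. In the application \<open>a\<close> is k - 1, while \<open>N\<close> and
  \<open>N'\<close> are numbers of classes.\<close>

lemma le_of_scaled_binomial:
  fixes n m m' a :: nat
  assumes "n \<ge> 2" "n < m" "n < m'" "a > 0"
    and "m * N = a * (m choose n)" "m' * N' = a * (m' choose n)" and "N' \<le> N"
  shows "m' \<le> m"
proof (rule ccontr)
  assume "\<not> m' \<le> m"
  then have lt: "m < m'" by simp
  have eq: "n * N = a * ((m - 1) choose (n - 1))" if "m * N = a * (m choose n)" "n < m" for m N
  proof -
    have "m * (n * N) = a * (n * (m choose n))" using that by (metis mult.left_commute)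
    also have "\<dots> = m * (a * ((m - 1) choose (n - 1)))"
      using binomial_absorption[of "n - 1" m] assms(1) that(2) by simp
    finally show ?thesis using that(2) by simp
  qed
  have "(m - 1) choose (n - 1) < (m' - 1) choose (n - 1)"
  proof -
    have "Suc (m - 1) choose Suc (n - 2) = (m - 1 choose (n - 2)) + (m - 1 choose Suc (n - 2))"
      by (rule binomial_Suc_Suc)
    moreover have "0 < (m - 1) choose (n - 2)" using assms by simp
    moreover have "(Suc (m - 1) choose Suc (n - 2)) \<le> ((m' - 1) choose Suc (n - 2))"
      by (rule binomial_right_mono) (use lt assms in simp)
    ultimately have "((m - 1) choose Suc (n - 2)) < ((m' - 1) choose Suc (n - 2))" by linarith
    moreover have "n - 1 = Suc (n - 2)" using assms(1) by simp
    ultimately show ?thesis by simp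
  qed
  then have "n * N < n * N'" unfolding eq[OF assms(5,2)] eq[OF assms(6,3)] using assms(4) by simp
  then show False using assms(7) by simp
qed

section \<open>Passage to companion matrices by a cyclic linear form\<close>

lemma smult_one_pow:
  "((z::complex) \<cdot>\<^sub>m 1\<^sub>m d) ^\<^sub>m j = z ^ j \<cdot>\<^sub>m 1\<^sub>m d"
proof (induction j)
  case (Suc j)
  have "(z ^ j \<cdot>\<^sub>m 1\<^sub>m d) * (z \<cdot>\<^sub>m 1\<^sub>m d) = z ^ Suc j \<cdot>\<^sub>m (1\<^sub>m d :: complex mat)"
    by (intro eq_matI) auto
  then show ?case using Suc by simp
qed auto

lemma intertwine_pow:
  fixes P M N :: "complex mat"
  assumes P: "P \<in> carrier_mat d d" and M: "M \<in> carrier_mat d d" and N: "N \<in> carrier_mat d d"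
    and eq: "P * M = N * P"
  shows "P * M ^\<^sub>m j = N ^\<^sub>m j * P"
proof (induction j)
  case (Suc j)
  have Mj: "M ^\<^sub>m j \<in> carrier_mat d d" and Nj: "N ^\<^sub>m j \<in> carrier_mat d d" using M N by auto
  have "P * M ^\<^sub>m Suc j = (P * M ^\<^sub>m j) * M" using assoc_mult_mat[OF P Mj M] by simp
  also have "\<dots> = N ^\<^sub>m j * (P * M)" unfolding Suc by (rule assoc_mult_mat[OF Nj P M])
  also have "\<dots> = N ^\<^sub>m Suc j * P" unfolding eq using assoc_mult_mat[OF Nj N P] by simp
  finally show ?case .
qed (use P M N in auto)


text \<open>\<open>A\<close>, \<open>B\<close>, \<open>X\<close>, \<open>C\<close> stand for the
  images of \<alpha>, \<beta>, x_n and \<gamma>. The assumption \<open>inj\<close> says that the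
  forms f A^j with j < d separate vectors, that is, form a basis of the dual space.\<close>

locale reflection_normal_form =
  fixes d k m s t :: nat and A B X C :: "complex mat" and e f :: "complex vec"
  assumes d: "d \<ge> 1" and k: "k \<ge> 1" and m: "m \<ge> 1" and st: "d * t = m * s + 1"
    and mats: "A \<in> carrier_mat d d" "B \<in> carrier_mat d d" "X \<in> carrier_mat d d" "C \<in> carrier_mat d d"
    and vecs: "e \<in> carrier_vec d" "f \<in> carrier_vec d" and e_nz: "e \<noteq> 0\<^sub>v d"
    and X_eq: "\<And>v. v \<in> carrier_vec d \<Longrightarrow> X *\<^sub>v v = v + (f \<bullet> v) \<cdot>\<^sub>v e"
    and B_eq: "B = A * X"
    and inj: "\<And>v. v \<in> carrier_vec d \<Longrightarrow> (\<And>j. j < d \<Longrightarrow> f \<bullet> (A ^\<^sub>m j *\<^sub>v v) = 0) \<Longrightarrow> v = 0\<^sub>v d"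
    and CX: "X * C = C * X" and CA: "A * C = C * A" and detC: "det C \<noteq> 0"
    and A_pow: "A ^\<^sub>m d = C ^\<^sub>m s" and B_pow: "B ^\<^sub>m m = C ^\<^sub>m t" and X_pow: "X ^\<^sub>m k = 1\<^sub>m d"
begin

lemma A_pow_carrier [simp]: "A ^\<^sub>m j \<in> carrier_mat d d" using mats by simp

lemma mv_carrier [simp]:
  "v \<in> carrier_vec d \<Longrightarrow> A *\<^sub>v v \<in> carrier_vec d" "v \<in> carrier_vec d \<Longrightarrow> B *\<^sub>v v \<in> carrier_vec d"
  "v \<in> carrier_vec d \<Longrightarrow> C *\<^sub>v v \<in> carrier_vec d" "v \<in> carrier_vec d \<Longrightarrow> X *\<^sub>v v \<in> carrier_vec d"
  "v \<in> carrier_vec d \<Longrightarrow> A ^\<^sub>m j *\<^sub>v v \<in> carrier_vec d"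
  by (rule mult_mat_vec_carrier[of _ d d]; use mats in simp)+

lemma f_add: "v \<in> carrier_vec d \<Longrightarrow> w \<in> carrier_vec d \<Longrightarrow> f \<bullet> (v + w) = f \<bullet> v + f \<bullet> w"
  by (rule scalar_prod_add_distrib[OF vecs(2)])

lemma f_smult: "v \<in> carrier_vec d \<Longrightarrow> f \<bullet> (z \<cdot>\<^sub>v v) = z * (f \<bullet> v)"
  using vecs by simp

lemma A_pow_add: "v \<in> carrier_vec d \<Longrightarrow> w \<in> carrier_vec d \<Longrightarrow>
    A ^\<^sub>m j *\<^sub>v (v + w) = A ^\<^sub>m j *\<^sub>v v + A ^\<^sub>m j *\<^sub>v w"
  by (rule mult_add_distrib_mat_vec[OF A_pow_carrier])

lemma A_pow_smult: "v \<in> carrier_vec d \<Longrightarrow> A ^\<^sub>m j *\<^sub>v (z \<cdot>\<^sub>v v) = z \<cdot>\<^sub>v (A ^\<^sub>m j *\<^sub>v v)"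
  by (rule mult_mat_vec[OF A_pow_carrier])

lemma A_pow_A: "v \<in> carrier_vec d \<Longrightarrow> A ^\<^sub>m j *\<^sub>v (A *\<^sub>v v) = A ^\<^sub>m Suc j *\<^sub>v v"
  using assoc_mult_mat_vec[OF A_pow_carrier mats(1)] by simp

lemma obtain_u: obtains u where "u \<in> carrier_vec d" "f \<bullet> u \<noteq> 0"
proof -
  have "unit_vec d 0 \<noteq> (0\<^sub>v d :: complex vec)" using d by simp
  then obtain j where "f \<bullet> (A ^\<^sub>m j *\<^sub>v unit_vec d 0) \<noteq> 0" using inj[of "unit_vec d 0"] by auto
  then show thesis using that[of "A ^\<^sub>m j *\<^sub>v unit_vec d 0"] by simp
qed

text \<open>Commuting with X = 1 + e f^T gives (f C v) e = (f v) C e, so f C is a multiple of f.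
  Commuting with \<open>A\<close> extends this to every f A^j with the same factor, and these forms
  separate vectors.\<close>

lemma C_scalar: obtains \<mu> where "\<mu> \<noteq> 0" "C = \<mu> \<cdot>\<^sub>m 1\<^sub>m d"
proof -
  obtain i where i: "i < d" "e $ i \<noteq> 0" using e_nz vecs by (auto simp: vec_eq_iff)
  define \<mu> where "\<mu> = (C *\<^sub>v e) $ i / e $ i"
  have f_C: "f \<bullet> (C *\<^sub>v v) = \<mu> * (f \<bullet> v)" if v: "v \<in> carrier_vec d" for v
  proof -
    have "C *\<^sub>v v + (f \<bullet> (C *\<^sub>v v)) \<cdot>\<^sub>v e = X *\<^sub>v (C *\<^sub>v v)" using X_eq v by simp
    also have "\<dots> = C *\<^sub>v (X *\<^sub>v v)"
      using assoc_mult_mat_vec[OF mats(3,4) v] assoc_mult_mat_vec[OF mats(4,3) v] CX by simp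
    also have "\<dots> = C *\<^sub>v v + (f \<bullet> v) \<cdot>\<^sub>v (C *\<^sub>v e)"
      using v vecs mats by (simp add: X_eq mult_add_distrib_mat_vec[of C d d] mult_mat_vec[of C d d])
    finally have "(C *\<^sub>v v + (f \<bullet> (C *\<^sub>v v)) \<cdot>\<^sub>v e) $ i = (C *\<^sub>v v + (f \<bullet> v) \<cdot>\<^sub>v (C *\<^sub>v e)) $ i" by simp
    then have "(f \<bullet> (C *\<^sub>v v)) * e $ i = (f \<bullet> v) * (C *\<^sub>v e) $ i"
      using i vecs v mats by (simp del: index_mult_mat_vec)
    then show ?thesis using i by (simp add: \<mu>_def field_simps)
  qed
  have com: "A ^\<^sub>m j *\<^sub>v (C *\<^sub>v v) = C *\<^sub>v (A ^\<^sub>m j *\<^sub>v v)" if v: "v \<in> carrier_vec d" for j v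
  proof -
    have "C * A ^\<^sub>m j = A ^\<^sub>m j * C" using intertwine_pow[OF mats(4,1,1)] CA by simp
    then show ?thesis
      using assoc_mult_mat_vec[OF mats(4) A_pow_carrier[of j] v]
        assoc_mult_mat_vec[OF A_pow_carrier[of j] mats(4) v] by simp
  qed
  have scalar: "C *\<^sub>v v = \<mu> \<cdot>\<^sub>v v" if v: "v \<in> carrier_vec d" for v
  proof -
    have "C *\<^sub>v v + (- \<mu>) \<cdot>\<^sub>v v = 0\<^sub>v d"
    proof (rule inj)
      fix j
      show "f \<bullet> (A ^\<^sub>m j *\<^sub>v (C *\<^sub>v v + - \<mu> \<cdot>\<^sub>v v)) = 0"
        using v by (simp add: A_pow_add A_pow_smult f_add f_smult com f_C)
    qed (use v in simp)
    then have "(C *\<^sub>v v + (- \<mu>) \<cdot>\<^sub>v v) $ j = 0" if "j < d" for j using that by simp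
    then have "(C *\<^sub>v v) $ j = \<mu> * v $ j" if "j < d" for j
      using that v mats by (simp del: index_mult_mat_vec)
    then show ?thesis using v mats by (intro eq_vecI) (auto simp del: index_mult_mat_vec)
  qed
  have C: "C = \<mu> \<cdot>\<^sub>m 1\<^sub>m d"
    by (rule mat_eq_by_mult_vec[OF mats(4)]) (auto simp: scalar smult_mat_mult_vec[of _ d])
  moreover have "\<mu> \<noteq> 0"
  proof
    assume "\<mu> = 0"
    then have "C *\<^sub>v unit_vec d 0 = 0\<^sub>v d" using scalar[of "unit_vec d 0"] by (auto intro: eq_vecI)
    moreover have "unit_vec d 0 \<noteq> (0\<^sub>v d :: complex vec)" using d by simp
    ultimately show False using detC det_0_iff_vec_prod_zero_field[OF mats(4)] unit_vec_carrier by blast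
  qed
  ultimately show thesis using that by blast
qed

lemma X_eigen: "X *\<^sub>v e = (1 + f \<bullet> e) \<cdot>\<^sub>v e"
  using X_eq[OF vecs(1)] vecs by (simp add: add_smult_distrib_vec)

lemma zeta_pow: "(1 + f \<bullet> e) ^ k = 1"
proof -
  have "eigenvector X e (1 + f \<bullet> e)" using mats vecs e_nz X_eigen by (simp add: eigenvector_def)
  then have "X ^\<^sub>m k *\<^sub>v e = (1 + f \<bullet> e) ^ k \<cdot>\<^sub>v e" using eigenvector_pow[OF mats(3)] by blast
  then have "e = (1 + f \<bullet> e) ^ k \<cdot>\<^sub>v e" using X_pow vecs by simp
  moreover obtain i where i: "i < d" "e $ i \<noteq> 0" using e_nz vecs by (auto simp: vec_eq_iff)
  ultimately have "e $ i = (1 + f \<bullet> e) ^ k * e $ i" using vecs by (metis carrier_vecD index_smult_vec(1))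
  then show ?thesis using i by simp
qed

text \<open>Otherwise \<open>X\<close> would be a transvection: its j-th power adds j (f u) e to u,
  which in characteristic zero contradicts X^k = 1.\<close>

lemma zeta_neq: "1 + f \<bullet> e \<noteq> 1"
proof
  assume "1 + f \<bullet> e = 1"
  then have fe: "f \<bullet> e = 0" by simp
  obtain u where u: "u \<in> carrier_vec d" "f \<bullet> u \<noteq> 0" by (rule obtain_u)
  have pow: "X ^\<^sub>m j *\<^sub>v u = u + (of_nat j * (f \<bullet> u)) \<cdot>\<^sub>v e" for j
  proof (induction j)
    case (Suc j)
    have Xj: "X ^\<^sub>m j \<in> carrier_mat d d" using mats by simp
    have "X ^\<^sub>m Suc j *\<^sub>v u = X *\<^sub>v (X ^\<^sub>m j *\<^sub>v u)"
      unfolding pow_mat_Suc_left[OF mats(3)] by (rule assoc_mult_mat_vec[OF mats(3) Xj u(1)])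
    also have "\<dots> = u + (of_nat (Suc j) * (f \<bullet> u)) \<cdot>\<^sub>v e"
      unfolding Suc using u vecs fe by (subst X_eq) (auto simp: f_add f_smult algebra_simps intro!: eq_vecI)
    finally show ?case .
  qed (use u vecs mats in \<open>auto intro!: eq_vecI\<close>)
  obtain i where i: "i < d" "e $ i \<noteq> 0" using e_nz vecs by (auto simp: vec_eq_iff)
  have "u $ i = (u + (of_nat k * (f \<bullet> u)) \<cdot>\<^sub>v e) $ i" using pow[of k] X_pow u by simp
  then show False using i u vecs k by simp
qed

text \<open>The number 1 + f e comes from a choice of e and f; here it is recovered from
  \<open>X\<close> alone. The eigenvalue 1 belongs to the fixed hyperplane.\<close>

lemma spectrum_X: "spectrum X - {1} = {1 + f \<bullet> e}"
proof
  have "eigenvector X e (1 + f \<bullet> e)" using mats vecs e_nz X_eigen by (simp add: eigenvector_def)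
  then show "{1 + f \<bullet> e} \<subseteq> spectrum X - {1}" using zeta_neq by (auto simp: spectrum_def eigenvalue_def)
  show "spectrum X - {1} \<subseteq> {1 + f \<bullet> e}"
  proof
    fix z assume "z \<in> spectrum X - {1}"
    then obtain v where z: "z \<noteq> 1" and v: "v \<in> carrier_vec d" "v \<noteq> 0\<^sub>v d" "X *\<^sub>v v = z \<cdot>\<^sub>v v"
      using mats by (auto simp: spectrum_def eigenvalue_def eigenvector_def)
    have eq: "z \<cdot>\<^sub>v v = v + (f \<bullet> v) \<cdot>\<^sub>v e" using X_eq v by simp
    have fz: "z * (f \<bullet> v) = f \<bullet> v + (f \<bullet> v) * (f \<bullet> e)"
      using arg_cong[OF eq, of "\<lambda>w. f \<bullet> w"] v vecs by (simp add: f_add f_smult)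
    have "f \<bullet> v \<noteq> 0"
    proof
      assume "f \<bullet> v = 0"
      have "z * v $ i = v $ i" if "i < d" for i
        using arg_cong[OF eq, of "\<lambda>w. w $ i"] that v vecs \<open>f \<bullet> v = 0\<close> by simp
      then have "v = 0\<^sub>v d" using z v by (intro eq_vecI) auto
      then show False using v by simp
    qed
    moreover have "(z - (1 + f \<bullet> e)) * (f \<bullet> v) = 0" using fz by (simp add: algebra_simps)
    ultimately have "z = 1 + f \<bullet> e" by simp
    then show "z \<in> {1 + f \<bullet> e}" by simp
  qed
qed

text \<open>Row j of \<open>\<Phi>\<close> is f A^j. In these coordinates \<open>A\<close> is a
  shift, closed up by A^d = \<mu>^s. Since B = A + (A e) f^T and f is coordinate 0, \<open>B\<close>
  differs from \<open>A\<close> only in the first column and is a companion matrix too. The value of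
  c (d - 1) will tie the product of the eigenvalues of \<open>B\<close> to \<zeta>.\<close>

theorem normal_form:
  "\<exists>\<Phi> c \<mu> \<zeta>. \<Phi> \<in> carrier_mat d d \<and> det \<Phi> \<noteq> 0 \<and> \<mu> \<noteq> 0 \<and> \<zeta> \<noteq> 1 \<and> \<zeta> ^ k = 1 \<and>
     \<Phi> * A = companion d (\<lambda>i. if i = d - 1 then \<mu> ^ s else 0) * \<Phi> \<and> \<Phi> * B = companion d c * \<Phi> \<and>
     c (d - 1) = \<mu> ^ s * \<zeta> \<and> companion_poly d c dvd monom 1 m - [:\<mu> ^ t:] \<and> spectrum X - {1} = {\<zeta>}"
proof -
  obtain \<mu> where \<mu>: "\<mu> \<noteq> 0" "C = \<mu> \<cdot>\<^sub>m 1\<^sub>m d" by (rule C_scalar)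
  define \<Phi> where "\<Phi> = mat d d (\<lambda>(j, i). ((A ^\<^sub>m j)\<^sup>T *\<^sub>v f) $ i)"
  have \<Phi>: "\<Phi> \<in> carrier_mat d d" by (simp add: \<Phi>_def)
  have \<Phi>_vec: "(\<Phi> *\<^sub>v v) $ j = f \<bullet> (A ^\<^sub>m j *\<^sub>v v)" if "j < d" "v \<in> carrier_vec d" for j v
  proof -
    have "row \<Phi> j = (A ^\<^sub>m j)\<^sup>T *\<^sub>v f"
      using that mats
      by (intro eq_vecI) (auto simp: \<Phi>_def simp del: index_mult_mat_vec split: if_splits)
    then show ?thesis
      using that \<Phi> transpose_vec_mult_scalar[OF A_pow_carrier that(2) vecs(2), of j] by simp
  qed
  have "det \<Phi> \<noteq> 0"
  proof (rule det_nonzeroI[OF \<Phi>])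
    fix v :: "complex vec" assume v: "v \<in> carrier_vec d" "\<Phi> *\<^sub>v v = 0\<^sub>v d"
    then show "v = 0\<^sub>v d" using \<Phi>_vec by (intro inj) (metis index_zero_vec(1))+
  qed
  have \<Phi>v: "\<Phi> *\<^sub>v v \<in> carrier_vec d" if "v \<in> carrier_vec d" for v
    by (rule mult_mat_vec_carrier[OF \<Phi> that])
  have A_d: "A ^\<^sub>m d = \<mu> ^ s \<cdot>\<^sub>m 1\<^sub>m d" unfolding A_pow \<mu>(2) by (rule smult_one_pow)
  have top: "f \<bullet> (A ^\<^sub>m Suc j *\<^sub>v v) = (if j = d - 1 then \<mu> ^ s * (f \<bullet> v) else f \<bullet> (A ^\<^sub>m Suc j *\<^sub>v v))"
    if "j < d" "v \<in> carrier_vec d" for j v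
  proof (cases "j = d - 1")
    case True
    then have "Suc j = d" using d by simp
    then have "A ^\<^sub>m Suc j *\<^sub>v v = \<mu> ^ s \<cdot>\<^sub>v v"
      using A_d that by (simp add: smult_mat_mult_vec[of _ d] del: pow_mat.simps)
    then show ?thesis using True that by (simp add: f_smult del: pow_mat.simps)
  qed simp
  have f0: "(\<Phi> *\<^sub>v v) $ 0 = f \<bullet> v" if "v \<in> carrier_vec d" for v
    using \<Phi>_vec[of 0 v] d that mats by simp
  let ?cA = "\<lambda>i. if i = d - 1 then \<mu> ^ s else 0"
  \<comment> \<open>The first term is what the reflection adds, namely coordinate j of A e; the
    second is the first column of the matrix of \<open>A\<close>.\<close>
  define c where "c j = f \<bullet> (A ^\<^sub>m Suc j *\<^sub>v e) + (if j = d - 1 then \<mu> ^ s else 0)" for j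
  have \<Phi>A: "\<Phi> * A = companion d ?cA * \<Phi>"
  proof (rule mat_eq_by_mult_vec[of _ d])
    fix v :: "complex vec" assume v: "v \<in> carrier_vec d"
    have "\<Phi> *\<^sub>v (A *\<^sub>v v) = companion d ?cA *\<^sub>v (\<Phi> *\<^sub>v v)"
    proof (rule eq_vecI)
      fix j assume "j < dim_vec (companion d ?cA *\<^sub>v (\<Phi> *\<^sub>v v))"
      then have j: "j < d" by (simp add: companion_def)
      show "(\<Phi> *\<^sub>v (A *\<^sub>v v)) $ j = (companion d ?cA *\<^sub>v (\<Phi> *\<^sub>v v)) $ j"
        unfolding companion_mult_vec[OF \<Phi>v[OF v] j] f0[OF v]
        using j v top[OF j v] \<Phi>_vec[of j "A *\<^sub>v v"] \<Phi>_vec[of "Suc j" v]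
        by (auto simp: A_pow_A simp del: pow_mat.simps index_mult_mat_vec)
    qed (use \<Phi> in \<open>simp add: companion_def\<close>)
    then show "\<Phi> * A *\<^sub>v v = companion d ?cA * \<Phi> *\<^sub>v v"
      using assoc_mult_mat_vec[OF \<Phi> mats(1) v] assoc_mult_mat_vec[OF companion_carrier \<Phi> v] by simp
  qed (use \<Phi> mats companion_carrier in \<open>auto intro!: mult_carrier_mat[of _ d d _ d]\<close>)
  have \<Phi>B: "\<Phi> * B = companion d c * \<Phi>"
  proof (rule mat_eq_by_mult_vec[of _ d])
    fix v :: "complex vec" assume v: "v \<in> carrier_vec d"
    have Bv: "B *\<^sub>v v = A *\<^sub>v v + (f \<bullet> v) \<cdot>\<^sub>v (A *\<^sub>v e)"
      unfolding B_eq using v vecs mats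
      by (simp add: assoc_mult_mat_vec[of _ d d _ d] X_eq mult_add_distrib_mat_vec[of _ d d] mult_mat_vec[of _ d d])
    have "\<Phi> *\<^sub>v (B *\<^sub>v v) = companion d c *\<^sub>v (\<Phi> *\<^sub>v v)"
    proof (rule eq_vecI)
      fix j assume "j < dim_vec (companion d c *\<^sub>v (\<Phi> *\<^sub>v v))"
      then have j: "j < d" by (simp add: companion_def)
      have "(\<Phi> *\<^sub>v (B *\<^sub>v v)) $ j = f \<bullet> (A ^\<^sub>m Suc j *\<^sub>v v) + (f \<bullet> v) * (f \<bullet> (A ^\<^sub>m Suc j *\<^sub>v e))"
        using j v vecs \<Phi>_vec[of j "B *\<^sub>v v"]
        by (simp add: Bv A_pow_add A_pow_smult f_add f_smult A_pow_A del: pow_mat.simps index_mult_mat_vec)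
      then show "(\<Phi> *\<^sub>v (B *\<^sub>v v)) $ j = (companion d c *\<^sub>v (\<Phi> *\<^sub>v v)) $ j"
        unfolding companion_mult_vec[OF \<Phi>v[OF v] j] f0[OF v]
        using j v top[OF j v] \<Phi>_vec[of "Suc j" v]
        by (auto simp: c_def algebra_simps simp del: pow_mat.simps index_mult_mat_vec)
    qed (use \<Phi> in \<open>simp add: companion_def\<close>)
    then show "\<Phi> * B *\<^sub>v v = companion d c * \<Phi> *\<^sub>v v"
      using assoc_mult_mat_vec[OF \<Phi> mats(2) v] assoc_mult_mat_vec[OF companion_carrier \<Phi> v] by simp
  qed (use \<Phi> mats companion_carrier in \<open>auto intro!: mult_carrier_mat[of _ d d _ d]\<close>)
  have c_last: "c (d - 1) = \<mu> ^ s * (1 + f \<bullet> e)"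
    using top[of "d - 1" e] d vecs by (simp add: c_def algebra_simps del: pow_mat.simps)
  have "companion d c ^\<^sub>m m = \<mu> ^ t \<cdot>\<^sub>m 1\<^sub>m d"
  proof -
    let ?K = "companion d c ^\<^sub>m m"
    have K: "?K \<in> carrier_mat d d" by simp
    have "?K * \<Phi> = \<Phi> * (\<mu> ^ t \<cdot>\<^sub>m 1\<^sub>m d)"
      using intertwine_pow[OF \<Phi> mats(2) companion_carrier \<Phi>B, of m] by (simp add: B_pow \<mu>(2) smult_one_pow)
    also have "\<dots> = (\<mu> ^ t \<cdot>\<^sub>m 1\<^sub>m d) * \<Phi>"
      using \<Phi> by (simp add: mult_smult_distrib[OF \<Phi>, of _ d] mult_smult_assoc_mat[of _ d d])
    finally have "?K * \<Phi> * inv\<^bsub>GL d\<^esub> \<Phi> = (\<mu> ^ t \<cdot>\<^sub>m 1\<^sub>m d) * \<Phi> * inv\<^bsub>GL d\<^esub> \<Phi>" by simp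
    then show ?thesis
      using GL_inv[OF \<Phi> \<open>det \<Phi> \<noteq> 0\<close>] K \<Phi> right_mult_one_mat[OF K]
      by (simp add: assoc_mult_mat[of _ d d _ d _ d])
  qed
  then have "companion_poly d c dvd monom 1 m - [:\<mu> ^ t:]" using companion_pow_scalar[OF d] by simp
  then show ?thesis
    using \<Phi> \<open>det \<Phi> \<noteq> 0\<close> \<mu>(1) zeta_neq zeta_pow \<Phi>A \<Phi>B c_last spectrum_X by blast
qed

end

section \<open>Classification of the reflection representations\<close>

definition reflection_rep :: "('a, 'b) monoid_scheme \<Rightarrow> 'a set \<Rightarrow> nat \<Rightarrow> ('a \<Rightarrow> complex mat) \<Rightarrow> bool" where
  "reflection_rep G R d \<rho> \<longleftrightarrow> \<rho> \<in> hom G (GL d) \<and> (\<forall>r\<in>R. fixes_hyperplane d (\<rho> r)) \<and>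
     (\<forall>v\<in>carrier_vec d. (\<forall>g\<in>carrier G. \<rho> g *\<^sub>v v = v) \<longrightarrow> v = 0\<^sub>v d)"

definition equivalent_rep :: "('a, 'b) monoid_scheme \<Rightarrow> nat \<Rightarrow> ('a \<Rightarrow> complex mat) \<Rightarrow> ('a \<Rightarrow> complex mat) \<Rightarrow> bool" where
  "equivalent_rep G d \<rho> \<rho>' \<longleftrightarrow>
     (\<exists>P\<in>carrier_mat d d. det P \<noteq> 0 \<and> (\<forall>g\<in>carrier G. P * \<rho> g = \<rho>' g * P))"

text \<open>An arbitrary isomorphism need not respect the condition on reflections; the assumption
  that \<open>\<phi>\<close> maps \<open>R\<close> onto \<open>R'\<close> is used for it.\<close>

lemma reflection_rep_pullback:
  assumes \<phi>: "\<phi> \<in> iso G H" and R: "\<phi> ` R = R'" and \<rho>: "reflection_rep H R' d \<rho>"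
  shows "reflection_rep G R d (\<rho> \<circ> \<phi>)"
proof -
  have hom: "\<phi> \<in> hom G H" and surj: "\<phi> ` carrier G = carrier H"
    using \<phi> by (auto simp: iso_def bij_betw_def)
  have "\<rho> \<circ> \<phi> \<in> hom G (GL d)" using hom \<rho> by (intro hom_compose) (auto simp: reflection_rep_def)
  moreover have "\<forall>r\<in>R. fixes_hyperplane d ((\<rho> \<circ> \<phi>) r)" using \<rho> R by (auto simp: reflection_rep_def)
  moreover have "v = 0\<^sub>v d" if "v \<in> carrier_vec d" "\<forall>g\<in>carrier G. (\<rho> \<circ> \<phi>) g *\<^sub>v v = v" for v
    using \<rho> that surj[symmetric] by (auto simp: reflection_rep_def)
  ultimately show ?thesis unfolding reflection_rep_def by blast
qed

lemma equivalent_rep_pullback: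
  assumes "\<phi> \<in> iso G H"
  shows "equivalent_rep G d (\<rho> \<circ> \<phi>) (\<rho>' \<circ> \<phi>) \<longleftrightarrow> equivalent_rep H d \<rho> \<rho>'"
proof -
  have "carrier H = \<phi> ` carrier G" using assms by (auto simp: iso_def bij_betw_def)
  then show ?thesis by (simp add: equivalent_rep_def)
qed

text \<open>\<open>R\<close> has to lie in the carrier because the inverse function undoes
  \<open>\<phi>\<close> only there.\<close>

lemma reflection_isomorphic_sym:
  assumes "group G" "R \<subseteq> carrier G" "reflection_isomorphic G R H R'"
  shows "reflection_isomorphic H R' G R"
proof -
  obtain \<phi> where \<phi>: "\<phi> \<in> iso G H" and R: "\<phi> ` R = R'"
    using assms by (auto simp: reflection_isomorphic_def)
  have "inv_into (carrier G) \<phi> ` R' = R"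
    unfolding R[symmetric] using \<phi> assms(2) by (intro inv_into_image_cancel) (auto simp: iso_def bij_betw_def)
  then show ?thesis
    unfolding reflection_isomorphic_def using group.iso_set_sym[OF assms(1) \<phi>] by blast
qed

lemma mult_vec_cancel:
  fixes M :: "complex mat"
  assumes M: "M \<in> carrier_mat d d" "det M \<noteq> 0" and v: "v \<in> carrier_vec d" and w: "w \<in> carrier_vec d"
    and eq: "M *\<^sub>v v = M *\<^sub>v w"
  shows "v = w"
proof -
  note inv = GL_inv[OF M]
  have "u = inv\<^bsub>GL d\<^esub> M *\<^sub>v (M *\<^sub>v u)" if "u \<in> carrier_vec d" for u
    using assoc_mult_mat_vec[OF inv(1) M(1) that] that unfolding inv(2) by simp
  then show ?thesis using v w eq by metis
qed

lemma det_nonzero_of_pow: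
  fixes A :: "complex mat"
  assumes A: "A \<in> carrier_mat d d" and pow: "A ^\<^sub>m j = z \<cdot>\<^sub>m 1\<^sub>m d" and z: "z \<noteq> 0" and j: "j \<ge> 1"
  shows "det A \<noteq> 0"
proof (rule det_nonzeroI[OF A])
  fix v :: "complex vec" assume v: "v \<in> carrier_vec d" "A *\<^sub>v v = 0\<^sub>v d"
  have c: "A ^\<^sub>m (j - 1) \<in> carrier_mat d d" using A by simp
  have "A ^\<^sub>m j = A ^\<^sub>m (j - 1) * A" using j by (cases j) auto
  then have "A ^\<^sub>m j *\<^sub>v v = A ^\<^sub>m (j - 1) *\<^sub>v (A *\<^sub>v v)"
    using assoc_mult_mat_vec[OF c A v(1)] by simp
  also have "\<dots> = 0\<^sub>v d" unfolding v(2) using A c by (intro eq_vecI) (auto intro!: scalar_prod_right_zero)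
  finally have "z \<cdot>\<^sub>v v = 0\<^sub>v d" unfolding pow using v by (simp add: smult_mat_mult_vec[of _ d])
  then have "z * v $ i = 0" if "i < d" for i using that v by (metis carrier_vecD index_smult_vec(1) index_zero_vec(1))
  then show "v = 0\<^sub>v d" using v z by (intro eq_vecI) auto
qed

lemma reflection_pow_one:
  fixes M :: "complex mat"
  assumes M: "M \<in> carrier_mat d d" and e: "e \<in> carrier_vec d" and f: "f \<in> carrier_vec d"
    and eq: "\<And>v. v \<in> carrier_vec d \<Longrightarrow> M *\<^sub>v v = v + (f \<bullet> v) \<cdot>\<^sub>v e"
    and fe: "f \<bullet> e = \<zeta> - 1" and \<zeta>: "\<zeta> \<noteq> 1" "\<zeta> ^ k = 1"
  shows "M ^\<^sub>m k = 1\<^sub>m d"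
proof (rule mat_eq_by_mult_vec[of _ d])
  fix v :: "complex vec" assume v: "v \<in> carrier_vec d"
  \<comment> \<open>The quotient is the geometric sum 1 + \<zeta> + ... + \<zeta>^(j-1), which
    vanishes at j = k.\<close>
  have "M ^\<^sub>m j *\<^sub>v v = v + ((\<zeta> ^ j - 1) / (\<zeta> - 1) * (f \<bullet> v)) \<cdot>\<^sub>v e" for j
  proof (induction j)
    case (Suc j)
    have Mj: "M ^\<^sub>m j \<in> carrier_mat d d" using M by simp
    let ?w = "v + ((\<zeta> ^ j - 1) / (\<zeta> - 1) * (f \<bullet> v)) \<cdot>\<^sub>v e"
    have w: "?w \<in> carrier_vec d" using v e by simp
    have "M ^\<^sub>m Suc j *\<^sub>v v = M *\<^sub>v ?w"
      unfolding pow_mat_Suc_left[OF M] Suc[symmetric] by (rule assoc_mult_mat_vec[OF M Mj v])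
    also have "\<dots> = ?w + (f \<bullet> ?w) \<cdot>\<^sub>v e" by (rule eq[OF w])
    also have "f \<bullet> ?w = \<zeta> ^ j * (f \<bullet> v)"
      using v e f \<zeta>(1) by (simp add: scalar_prod_add_distrib[of f d] fe field_simps)
    also have "?w + (\<zeta> ^ j * (f \<bullet> v)) \<cdot>\<^sub>v e = v + ((\<zeta> ^ Suc j - 1) / (\<zeta> - 1) * (f \<bullet> v)) \<cdot>\<^sub>v e"
      using v e \<zeta>(1) by (intro eq_vecI) (auto simp: field_simps)
    finally show ?case .
  qed (use v M e in \<open>auto intro!: eq_vecI\<close>)
  from this[of k] show "M ^\<^sub>m k *\<^sub>v v = 1\<^sub>m d *\<^sub>v v"
    using v e \<zeta> by (auto intro!: eq_vecI)
qed (use M in auto)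

lemma companion_cong: "(\<And>i. i < d \<Longrightarrow> c i = c' i) \<Longrightarrow> companion d c = companion d c'"
  unfolding companion_def by (rule cong_mat) auto

definition Cstar :: "complex monoid" where
  "Cstar = \<lparr>carrier = - {0}, monoid.mult = (*), one = 1\<rparr>"

lemma Cstar_simps [simp]:
  "z \<in> carrier Cstar \<longleftrightarrow> z \<noteq> 0" "a \<otimes>\<^bsub>Cstar\<^esub> b = a * b" "\<one>\<^bsub>Cstar\<^esub> = 1"
  by (simp_all add: Cstar_def)

lemma group_Cstar: "group Cstar"
proof (rule groupI)
  show "\<exists>b\<in>carrier Cstar. b \<otimes>\<^bsub>Cstar\<^esub> a = \<one>\<^bsub>Cstar\<^esub>" if "a \<in> carrier Cstar" for a
    using that by (intro bexI[of _ "inverse a"]) auto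
qed auto

lemma Cstar_pow: "z [^]\<^bsub>Cstar\<^esub> (j::nat) = z ^ j"
  by (induction j) simp_all

section \<open>Reflection representations of the toric group\<close>

locale toric =
  fixes k n m s t :: nat
  assumes k2: "k \<ge> 2" and n2: "n \<ge> 2" and m1: "m \<ge> 1" and st0: "n * t = m * s + 1"

sublocale toric \<subseteq> toric_pair "toric_group k n m" k n m s t "\<lambda>j. toric_gen k n m (Suc j)"
proof -
  interpret group "toric_group k n m" by (rule group_toric_group)
  show "toric_pair (toric_group k n m) k n m s t (\<lambda>j. toric_gen k n m (Suc j))"
    by unfold_locales (use n2 st0 toric_tuple_toric_gen[of n k m] in auto)
qed

context toric
begin

abbreviation W where "W \<equiv> toric_group k n m"
abbreviation R where "R \<equiv> toric_reflections k n m"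
abbreviation x where "x j \<equiv> toric_gen k n m (Suc j)"

lemma generated_\<alpha>_\<beta>:
  assumes H: "subgroup H W" and "\<alpha> \<in> H" "\<beta> \<in> H"
  shows "H = carrier W"
proof (rule toric_group_generated[OF n_pos H])
  fix j :: nat
  interpret H: subgroup H W by (rule H)
  have "\<alpha> [^]\<^bsub>W\<^esub> j \<in> H" using assms(2) by (induction j) auto
  then show "x j \<in> H" unfolding y_conj[of j] using assms by auto
qed

lemma hom_GL:
  assumes "\<rho> \<in> hom W (GL d)"
  shows "group_hom W (GL d) \<rho>"
  using assms group_GL by (intro group_hom.intro group_hom_axioms.intro) (auto intro: group_toric_group)

lemma fixed_of_generators:
  assumes \<rho>: "\<rho> \<in> hom W (GL d)" and v: "v \<in> carrier_vec d"
    and gen: "\<And>j. j < n \<Longrightarrow> \<rho> (x j) *\<^sub>v v = v" and g: "g \<in> carrier W"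
  shows "\<rho> g *\<^sub>v v = v"
proof -
  interpret h: group_hom W "GL d" \<rho> by (rule hom_GL[OF \<rho>])
  let ?H = "{g \<in> carrier W. \<rho> g *\<^sub>v v = v}"
  have c: "\<rho> g \<in> carrier_mat d d" "det (\<rho> g) \<noteq> 0" if "g \<in> carrier W" for g
    using h.hom_closed[OF that] by auto
  have "subgroup ?H W"
  proof (rule subgroupI)
    fix a assume a: "a \<in> ?H"
    then have "\<rho> (inv\<^bsub>W\<^esub> a) *\<^sub>v v = inv\<^bsub>GL d\<^esub> (\<rho> a) *\<^sub>v (\<rho> a *\<^sub>v v)" by (simp add: h.hom_inv)
    also have "\<dots> = (inv\<^bsub>GL d\<^esub> (\<rho> a) * \<rho> a) *\<^sub>v v"
      using assoc_mult_mat_vec[OF GL_inv(1)[OF c] c(1) v] a by simp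
    also have "\<dots> = v" using GL_inv[OF c] a v by simp
    finally show "inv\<^bsub>W\<^esub> a \<in> ?H" using a by simp
  next
    fix a b assume "a \<in> ?H" "b \<in> ?H"
    then show "a \<otimes>\<^bsub>W\<^esub> b \<in> ?H"
      using assoc_mult_mat_vec[OF c(1) c(1) v, of a b] by simp
  next
    have "\<one>\<^bsub>W\<^esub> \<in> ?H" using h.hom_one v by simp
    then show "?H \<noteq> {}" by blast
  qed auto
  moreover have "x j \<in> ?H" for j
  proof -
    have "x (j mod n) = x j" by (rule periodic_mod) (rule per)
    then show ?thesis using gen[of "j mod n"] n2 by simp
  qed
  ultimately have "?H = carrier W" by (intro toric_group_generated[OF n_pos])
  then show ?thesis using g by blast
qed

text \<open>A generator belongs to \<open>R\<close> only if it is not 1, which has not been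
  established at this point; a trivial generator acts as the identity, which fixes a hyperplane as
  well.\<close>

lemma x_fixes_hyperplane:
  assumes "reflection_rep W R d \<rho>"
  shows "fixes_hyperplane d (\<rho> (x j))"
proof (cases "x j = \<one>\<^bsub>W\<^esub>")
  case True
  interpret h: group_hom W "GL d" \<rho> by (rule hom_GL) (use assms in \<open>simp add: reflection_rep_def\<close>)
  show ?thesis using True h.hom_one fixes_hyperplane_one by simp
next
  case False
  have per': "x (j mod n) = x j" by (rule periodic_mod) (rule per)
  have "x j = \<one>\<^bsub>W\<^esub> \<otimes>\<^bsub>W\<^esub> toric_gen k n m (Suc (j mod n)) [^]\<^bsub>W\<^esub> (1::int) \<otimes>\<^bsub>W\<^esub> inv\<^bsub>W\<^esub> \<one>\<^bsub>W\<^esub>"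
    by (simp add: per')
  moreover have "Suc (j mod n) \<in> {1..n}" using n2 by (simp add: Suc_le_eq)
  moreover have "toric_gen k n m (Suc (j mod n)) [^]\<^bsub>W\<^esub> (1::int) \<noteq> \<one>\<^bsub>W\<^esub>" using False by (simp add: per')
  ultimately have "x j \<in> R" unfolding toric_reflections_def Let_def by blast
  then show ?thesis using assms by (auto simp: reflection_rep_def)
qed

text \<open>If d > n, the n hyperplanes fixed by the generators share a nonzero vector, and the
  whole group fixes it.\<close>

lemma dimension_le:
  assumes \<rho>: "reflection_rep W R d \<rho>"
  shows "d \<le> n"
proof (rule ccontr)
  assume "\<not> d \<le> n"
  then have "n < d" by simp
  have hom: "\<rho> \<in> hom W (GL d)" using \<rho> by (simp add: reflection_rep_def)
  have "\<exists>f. f \<in> carrier_vec d \<and> (\<forall>v\<in>carrier_vec d. f \<bullet> v = 0 \<longrightarrow> \<rho> (x j) *\<^sub>v v = v)" for j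
    using x_fixes_hyperplane[OF \<rho>] by (auto simp: fixes_hyperplane_def)
  then obtain f where f: "\<And>j. f j \<in> carrier_vec d"
    "\<And>j v. v \<in> carrier_vec d \<Longrightarrow> f j \<bullet> v = 0 \<Longrightarrow> \<rho> (x j) *\<^sub>v v = v" by metis
  obtain v where v: "v \<in> carrier_vec d" "v \<noteq> 0\<^sub>v d" "\<And>j. j < n \<Longrightarrow> f j \<bullet> v = 0"
    using common_kernel[of f d n, OF f(1) \<open>n < d\<close>] by blast
  have "\<rho> g *\<^sub>v v = v" if "g \<in> carrier W" for g
    by (rule fixed_of_generators[OF hom v(1) _ that]) (use f v in auto)
  then show False using \<rho> v by (auto simp: reflection_rep_def)
qed

text \<open>The m-th power of \<open>base \<zeta>\<close> is the scalar \<mu> by which \<gamma>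
  acts. The sign comes from the constant coefficient of a monic polynomial of degree n: the last
  entry \<mu>^s \<zeta> of the first column for \<beta> equals (-1)^(n+1) times the product of the
  eigenvalues.\<close>

definition base where "base \<zeta> = (-1) ^ (n + 1) * (\<zeta>::complex)"
definition coeffs_\<alpha> where "coeffs_\<alpha> \<zeta> i = (if i = n - 1 then (base \<zeta> ^ m) ^ s else 0)"
definition coeffs_\<beta> where "coeffs_\<beta> S i = - coeff (\<Prod>b\<in>S. [:- b, 1 :: complex:]) (n - 1 - i)"

text \<open>Let b = \<open>base \<zeta>\<close> and \<mu> = b^m. The eigenvalues of \<beta> are m-th
  roots of \<mu>^t = (b^t)^m, and their product is b \<mu>^s = b^(m s + 1) = (b^t)^n; hence the
  argument b^t of \<open>root_sets\<close>.\<close>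

definition admissible where
  "admissible \<zeta> S \<longleftrightarrow> \<zeta> ^ k = 1 \<and> \<zeta> \<noteq> 1 \<and> S \<in> root_sets n m (base \<zeta> ^ t)"

lemma base_nz: "\<zeta> ^ k = 1 \<Longrightarrow> base \<zeta> \<noteq> 0"
  using k2 by (auto simp: base_def power_0_left)

lemma companion_poly_coeffs_\<beta>:
  assumes "card S = n"
  shows "companion_poly n (coeffs_\<beta> S) = (\<Prod>b\<in>S. [:- b, 1:])"
proof (rule poly_eqI)
  let ?Q = "\<Prod>b\<in>S. [:- b, 1 :: complex:]"
  have deg: "degree ?Q = n" using assms by (simp add: degree_prod_eq_sum_degree)
  have "lead_coeff ?Q = 1" by (simp add: lead_coeff_prod)
  then show "coeff (companion_poly n (coeffs_\<beta> S)) i = coeff ?Q i" for i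
    using deg n2 by (auto simp: coeff_companion_poly coeffs_\<beta>_def coeff_eq_0)
qed

lemma spectrum_coeffs_\<beta>:
  assumes "card S = n"
  shows "spectrum (companion n (coeffs_\<beta> S)) = S"
proof -
  have "finite S" using assms n2 by (auto intro: card_ge_0_finite)
  then show ?thesis
    unfolding spectrum_companion[OF n_pos] companion_poly_coeffs_\<beta>[OF assms] by (auto simp: poly_prod)
qed

lemma coeffs_\<beta>_last:
  assumes "card S = n"
  shows "coeffs_\<beta> S (n - 1) = (-1) ^ (n + 1) * \<Prod>S"
proof -
  have "coeff (\<Prod>b\<in>S. [:- b, 1 :: complex:]) 0 = (\<Prod>b\<in>S. - b)"
    by (simp add: poly_prod flip: poly_0_coeff_0)
  also have "\<dots> = (\<Prod>b\<in>S. (-1) * b)" by (rule prod.cong) simp_all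
  also have "\<dots> = (-1) ^ n * \<Prod>S" unfolding prod.distrib using assms by simp
  finally show ?thesis by (simp add: coeffs_\<beta>_def)
qed

text \<open>As \<open>x\<close> counts from 0, \<open>x (n - 1)\<close> is the generator x_n. Using
  spectra keeps the invariant free of any choice of coordinates.\<close>

definition invariant where
  "invariant \<rho> = (spectrum (\<rho> (x (n - 1))) - {1}, spectrum (\<rho> \<beta>))"

lemma rep_normal_form:
  assumes \<rho>: "reflection_rep W R n \<rho>"
  shows "\<exists>\<zeta> S \<Phi>. admissible \<zeta> S \<and> invariant \<rho> = ({\<zeta>}, S) \<and> \<Phi> \<in> carrier_mat n n \<and> det \<Phi> \<noteq> 0 \<and>
     \<Phi> * \<rho> \<alpha> = companion n (coeffs_\<alpha> \<zeta>) * \<Phi> \<and> \<Phi> * \<rho> \<beta> = companion n (coeffs_\<beta> S) * \<Phi>"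
proof -
  have hom: "\<rho> \<in> hom W (GL n)" using \<rho> by (simp add: reflection_rep_def)
  interpret h: group_hom W "GL n" \<rho> by (rule hom_GL[OF hom])
  have c: "\<rho> g \<in> carrier_mat n n" "det (\<rho> g) \<noteq> 0" if "g \<in> carrier W" for g
    using h.hom_closed[OF that] by auto
  have pow: "\<rho> (g [^]\<^bsub>W\<^esub> (j::nat)) = \<rho> g ^\<^sub>m j" if "g \<in> carrier W" for g j
    using h.hom_nat_pow[OF that] GL_pow c(1)[OF that] by simp
  have mult: "\<rho> (a \<otimes>\<^bsub>W\<^esub> b) = \<rho> a * \<rho> b" if "a \<in> carrier W" "b \<in> carrier W" for a b
    using h.hom_mult[OF that] by simp
  let ?X = "\<rho> (x (n - 1))"
  obtain e f where ef: "e \<in> carrier_vec n" "f \<in> carrier_vec n"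
    and X: "\<And>v. v \<in> carrier_vec n \<Longrightarrow> ?X *\<^sub>v v = v + (f \<bullet> v) \<cdot>\<^sub>v e"
    using hyperplane_form[OF c(1)[OF y] x_fixes_hyperplane[OF \<rho>]] by blast
  \<comment> \<open>If x_n fixes all \<alpha>^j v, then v is fixed by the conjugates \<alpha>^(-j)
    x_n \<alpha>^j, which are all the generators. Keeping the factor \<open>e\<close> in the
    hypothesis covers the case e = 0, from which \<open>e_nz\<close> follows.\<close>
  have inj: "v = 0\<^sub>v n"
    if v: "v \<in> carrier_vec n" and fv: "\<And>j. j < n \<Longrightarrow> (f \<bullet> (\<rho> \<alpha> ^\<^sub>m j *\<^sub>v v)) \<cdot>\<^sub>v e = 0\<^sub>v n" for v
  proof -
    have "\<rho> (x i) *\<^sub>v v = v" if i: "i < n" for i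
    proof -
      define j where "j = n - 1 - i"
      have j: "j < n" "i + j = n - 1" using i n2 by (auto simp: j_def)
      let ?a = "\<rho> \<alpha> ^\<^sub>m j" and ?b = "\<rho> (x i)"
      have a: "?a \<in> carrier_mat n n" "det ?a \<noteq> 0" using c[of "\<alpha> [^]\<^bsub>W\<^esub> j"] pow by auto
      have b: "?b \<in> carrier_mat n n" using c by simp
      have "?a * ?b = ?X * ?a"
        using arg_cong[OF \<alpha>_y_pow[of j i], of \<rho>] j by (simp add: mult pow toric_gen_closed[OF n_pos])
      then have "?a *\<^sub>v (?b *\<^sub>v v) = ?X *\<^sub>v (?a *\<^sub>v v)"
        using assoc_mult_mat_vec[OF a(1) b v] assoc_mult_mat_vec[OF c(1)[OF y] a(1) v] by simp
      also have "\<dots> = ?a *\<^sub>v v"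
        using X[of "?a *\<^sub>v v"] fv[OF j(1)] mult_mat_vec_carrier[OF a(1) v] by simp
      finally show ?thesis by (rule mult_vec_cancel[OF a mult_mat_vec_carrier[OF b v] v])
    qed
    then have "\<forall>g\<in>carrier W. \<rho> g *\<^sub>v v = v" using fixed_of_generators[OF hom v] by blast
    then show ?thesis using \<rho> v by (auto simp: reflection_rep_def)
  qed
  have e_nz: "e \<noteq> 0\<^sub>v n"
  proof
    assume e0: "e = 0\<^sub>v n"
    have "z \<cdot>\<^sub>v e = 0\<^sub>v n" for z unfolding e0 by (rule eq_vecI) simp_all
    then have "unit_vec n 0 = (0\<^sub>v n :: complex vec)" using inj[OF unit_vec_carrier] by blast
    then show False using n2 by simp
  qed
  interpret nf: reflection_normal_form n k m s t "\<rho> \<alpha>" "\<rho> \<beta>" ?X "\<rho> \<gamma>" e f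
  proof
    show "\<rho> \<beta> = \<rho> \<alpha> * ?X" using arg_cong[OF \<alpha>_y_last, of \<rho>] by (simp add: mult)
    show "v = 0\<^sub>v n" if "v \<in> carrier_vec n" "\<And>j. j < n \<Longrightarrow> f \<bullet> (\<rho> \<alpha> ^\<^sub>m j *\<^sub>v v) = 0" for v
    proof (rule inj[OF that(1)])
      fix j assume "j < n"
      have "0 \<cdot>\<^sub>v e = 0\<^sub>v n" using ef(1) by (intro eq_vecI) auto
      then show "(f \<bullet> (\<rho> \<alpha> ^\<^sub>m j *\<^sub>v v)) \<cdot>\<^sub>v e = 0\<^sub>v n" unfolding that(2)[OF \<open>j < n\<close>] .
    qed
    show "?X * \<rho> \<gamma> = \<rho> \<gamma> * ?X" using arg_cong[OF \<gamma>_y[of "n - 1"], of \<rho>] by (simp add: mult)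
    show "\<rho> \<alpha> * \<rho> \<gamma> = \<rho> \<gamma> * \<rho> \<alpha>" using arg_cong[OF \<gamma>_\<alpha>, of \<rho>] by (simp add: mult)
    show "\<rho> \<alpha> ^\<^sub>m n = \<rho> \<gamma> ^\<^sub>m s" using arg_cong[OF \<alpha>_pow, of \<rho>] by (simp add: pow)
    show "\<rho> \<beta> ^\<^sub>m m = \<rho> \<gamma> ^\<^sub>m t" using arg_cong[OF \<beta>_pow, of \<rho>] by (simp add: pow)
    show "?X ^\<^sub>m k = 1\<^sub>m n" using arg_cong[OF ypow[of "n - 1"], of \<rho>] h.hom_one by (simp add: pow)
  qed (use n2 k2 m1 st0 ef e_nz X c in \<open>auto simp: toric_gen_closed[OF n_pos]\<close>)
  obtain \<Phi> cB \<mu> \<zeta> where \<Phi>: "\<Phi> \<in> carrier_mat n n" "det \<Phi> \<noteq> 0" and \<mu>: "\<mu> \<noteq> 0"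
    and \<zeta>: "\<zeta> \<noteq> 1" "\<zeta> ^ k = 1"
    and \<Phi>A: "\<Phi> * \<rho> \<alpha> = companion n (\<lambda>i. if i = n - 1 then \<mu> ^ s else 0) * \<Phi>"
    and \<Phi>B: "\<Phi> * \<rho> \<beta> = companion n cB * \<Phi>" and last: "cB (n - 1) = \<mu> ^ s * \<zeta>"
    and dvd: "companion_poly n cB dvd monom 1 m - [:\<mu> ^ t:]" and spec: "spectrum ?X - {1} = {\<zeta>}"
    using nf.normal_form by blast
  define S where "S = {z. poly (companion_poly n cB) z = 0}"
  have "\<mu> ^ t \<noteq> 0" using \<mu> by simp
  note roots = roots_of_dvd_binomial[OF dvd this m1 companion_poly_monic(2), folded S_def]
  have card_S: "card S = n" using roots(2) companion_poly_monic(1) by simp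
  have cB: "companion n cB = companion n (coeffs_\<beta> S)"
  proof (rule companion_cong)
    fix i assume i: "i < n"
    have "coeff (companion_poly n cB) (n - 1 - i) = coeff (companion_poly n (coeffs_\<beta> S)) (n - 1 - i)"
      using companion_poly_coeffs_\<beta>[OF card_S] roots(3) by simp
    then show "cB i = coeffs_\<beta> S i" using i by (simp add: coeff_companion_poly split: if_splits)
  qed
  have prod_S: "\<Prod>S = base \<zeta> * \<mu> ^ s"
  proof -
    have "coeff (companion_poly n cB) 0 = coeff (companion_poly n (coeffs_\<beta> S)) 0"
      using companion_poly_coeffs_\<beta>[OF card_S] roots(3) by simp
    then have "\<mu> ^ s * \<zeta> = (-1) ^ (n + 1) * \<Prod>S"
      using last coeffs_\<beta>_last[OF card_S] n2 by (simp add: coeff_companion_poly)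
    then have "(-1) ^ (n + 1) * (\<mu> ^ s * \<zeta>) = ((-1) ^ (n + 1) * (-1) ^ (n + 1)) * \<Prod>S" by simp
    also have "(-1) ^ (n + 1) * (-1) ^ (n + 1) = (1::complex)" by (simp flip: power_add)
    finally show ?thesis by (simp add: base_def mult_ac)
  qed
  \<comment> \<open>The m-th power of the product of \<open>S\<close> is computed twice, from
    \<open>prod_S\<close> and as a product of n factors \<mu>^t; since n t = m s + 1, one factor
    \<mu> remains after cancelling.\<close>
  have \<mu>_eq: "\<mu> = base \<zeta> ^ m"
  proof -
    have "(\<Prod>S) ^ m = (\<Prod>z\<in>S. z ^ m)" by (simp add: prod_power_distrib)
    also have "\<dots> = (\<Prod>z\<in>S. \<mu> ^ t)" using roots(1) by (intro prod.cong) auto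
    also have "\<dots> = \<mu> ^ (n * t)" by (simp add: card_S mult.commute flip: power_mult)
    also have "\<dots> = \<mu> * \<mu> ^ (m * s)" by (simp add: st0)
    finally have "base \<zeta> ^ m * \<mu> ^ (m * s) = \<mu> * \<mu> ^ (m * s)"
      unfolding prod_S by (simp add: power_mult_distrib mult.commute flip: power_mult)
    then show ?thesis using \<mu> by simp
  qed
  have "S \<in> root_sets n m (base \<zeta> ^ t)"
  proof -
    have "(base \<zeta> ^ t) ^ m = \<mu> ^ t" unfolding \<mu>_eq by (simp add: mult.commute flip: power_mult)
    moreover have "(base \<zeta> ^ t) ^ n = base \<zeta> * \<mu> ^ s"
    proof -
      have "(base \<zeta> ^ t) ^ n = base \<zeta> ^ (n * t)" by (simp add: mult.commute flip: power_mult)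
      then show ?thesis unfolding \<mu>_eq st0 by (simp add: power_mult)
    qed
    ultimately show ?thesis using roots(1) card_S prod_S by (simp add: root_sets_def)
  qed
  then have "admissible \<zeta> S" using \<zeta> by (simp add: admissible_def)
  moreover have "spectrum (\<rho> \<beta>) = S"
    using spectrum_conj[OF c(1) companion_carrier \<Phi>, of \<beta> cB] \<Phi>B spectrum_coeffs_\<beta>[OF card_S] cB by simp
  moreover have "companion n (\<lambda>i. if i = n - 1 then \<mu> ^ s else 0) = companion n (coeffs_\<alpha> \<zeta>)"
    by (rule companion_cong) (simp add: coeffs_\<alpha>_def \<mu>_eq)
  ultimately show ?thesis
    using \<Phi> \<Phi>A \<Phi>B cB spec unfolding invariant_def by metis
qed

text \<open>Equal invariants give the same pair of companion matrices. The quotient of the two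
  changes of basis then intertwines the images of \<open>\<alpha>\<close> and
  \<open>\<beta>\<close>, hence those of the group they generate.\<close>

lemma equivalent_rep_iff_invariant:
  assumes \<rho>: "reflection_rep W R n \<rho>" and \<rho>': "reflection_rep W R n \<rho>'"
  shows "equivalent_rep W n \<rho> \<rho>' \<longleftrightarrow> invariant \<rho> = invariant \<rho>'"
proof
  have hom: "\<rho> \<in> hom W (GL n)" "\<rho>' \<in> hom W (GL n)" using \<rho> \<rho>' by (auto simp: reflection_rep_def)
  interpret h: group_hom W "GL n" \<rho> by (rule hom_GL[OF hom(1)])
  interpret h': group_hom W "GL n" \<rho>' by (rule hom_GL[OF hom(2)])
  have c: "\<rho> g \<in> carrier_mat n n" "\<rho>' g \<in> carrier_mat n n" if "g \<in> carrier W" for g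
    using h.hom_closed[OF that] h'.hom_closed[OF that] by auto
  {
    assume "equivalent_rep W n \<rho> \<rho>'"
    then obtain P where P: "P \<in> carrier_mat n n" "det P \<noteq> 0" "\<And>g. g \<in> carrier W \<Longrightarrow> P * \<rho> g = \<rho>' g * P"
      by (auto simp: equivalent_rep_def)
    have "spectrum (\<rho> g) = spectrum (\<rho>' g)" if "g \<in> carrier W" for g
      by (rule spectrum_conj[OF c(1)[OF that] c(2)[OF that] P(1,2) P(3)[OF that]])
    from this[OF y] this[OF closed(3)] show "invariant \<rho> = invariant \<rho>'" by (simp add: invariant_def)
  next
    assume inv: "invariant \<rho> = invariant \<rho>'"
    obtain \<zeta> S \<Phi> where \<zeta>: "invariant \<rho> = ({\<zeta>}, S)" and \<Phi>: "\<Phi> \<in> carrier_mat n n" "det \<Phi> \<noteq> 0"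
      and A: "\<Phi> * \<rho> \<alpha> = companion n (coeffs_\<alpha> \<zeta>) * \<Phi>" and B: "\<Phi> * \<rho> \<beta> = companion n (coeffs_\<beta> S) * \<Phi>"
      using rep_normal_form[OF \<rho>] by blast
    obtain \<zeta>' S' \<Psi> where \<zeta>': "invariant \<rho>' = ({\<zeta>'}, S')" and \<Psi>: "\<Psi> \<in> carrier_mat n n" "det \<Psi> \<noteq> 0"
      and A': "\<Psi> * \<rho>' \<alpha> = companion n (coeffs_\<alpha> \<zeta>') * \<Psi>" and B': "\<Psi> * \<rho>' \<beta> = companion n (coeffs_\<beta> S') * \<Psi>"
      using rep_normal_form[OF \<rho>'] by blast
    have eq: "\<zeta>' = \<zeta>" "S' = S" using inv \<zeta> \<zeta>' by auto
    let ?\<Psi> = "inv\<^bsub>GL n\<^esub> \<Psi>"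
    note \<Psi>' = GL_inv[OF \<Psi>]
    define P where "P = ?\<Psi> * \<Phi>"
    have P: "P \<in> carrier (GL n)"
      using h.H.m_closed[of ?\<Psi> \<Phi>] h.H.inv_closed[of \<Psi>] \<Phi> \<Psi> unfolding P_def by simp
    have inter: "P * M = N * P"
      if M: "M \<in> carrier_mat n n" and N: "N \<in> carrier_mat n n" and K: "K \<in> carrier_mat n n"
        and "\<Phi> * M = K * \<Phi>" "\<Psi> * N = K * \<Psi>" for M N K
    proof -
      note assoc = assoc_mult_mat[of _ n n _ n _ n]
      have "P * M = ?\<Psi> * (\<Phi> * M)" unfolding P_def by (rule assoc[OF \<Psi>'(1) \<Phi>(1) M])
      also have "\<dots> = (?\<Psi> * K) * \<Phi>" unfolding that(4) by (rule assoc[OF \<Psi>'(1) K \<Phi>(1), symmetric])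
      also have "?\<Psi> * K = N * ?\<Psi>"
      proof -
        have "?\<Psi> * K = ?\<Psi> * (K * (\<Psi> * ?\<Psi>))" using K \<Psi>'(3) by simp
        also have "K * (\<Psi> * ?\<Psi>) = (\<Psi> * N) * ?\<Psi>"
          unfolding that(5) by (rule assoc[OF K \<Psi>(1) \<Psi>'(1), symmetric])
        also have "\<dots> = \<Psi> * (N * ?\<Psi>)" by (rule assoc[OF \<Psi>(1) N \<Psi>'(1)])
        also have "?\<Psi> * (\<Psi> * (N * ?\<Psi>)) = (?\<Psi> * \<Psi>) * (N * ?\<Psi>)"
          by (rule assoc[OF \<Psi>'(1) \<Psi>(1) mult_carrier_mat[OF N \<Psi>'(1)], symmetric])
        also have "\<dots> = N * ?\<Psi>"
          unfolding \<Psi>'(2) by (rule left_mult_one_mat[OF mult_carrier_mat[OF N \<Psi>'(1)]])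
        finally show ?thesis .
      qed
      also have "(N * ?\<Psi>) * \<Phi> = N * P" unfolding P_def by (rule assoc[OF N \<Psi>'(1) \<Phi>(1)])
      finally show ?thesis .
    qed
    let ?H = "{g \<in> carrier W. P \<otimes>\<^bsub>GL n\<^esub> \<rho> g = \<rho>' g \<otimes>\<^bsub>GL n\<^esub> P}"
    note cl = h.hom_closed h'.hom_closed
    have "subgroup ?H W"
    proof (rule subgroupI)
      have "P \<otimes>\<^bsub>GL n\<^esub> \<rho> \<one>\<^bsub>W\<^esub> = \<rho>' \<one>\<^bsub>W\<^esub> \<otimes>\<^bsub>GL n\<^esub> P"
        unfolding h.hom_one h'.hom_one using P h.H.l_one h.H.r_one by metis
      then have "\<one>\<^bsub>W\<^esub> \<in> ?H" by blast
      then show "?H \<noteq> {}" by blast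
    next
      fix a assume "a \<in> ?H"
      then have a: "a \<in> carrier W" and eqa: "P \<otimes>\<^bsub>GL n\<^esub> \<rho> a = \<rho>' a \<otimes>\<^bsub>GL n\<^esub> P" by auto
      have "P \<otimes>\<^bsub>GL n\<^esub> inv\<^bsub>GL n\<^esub> (\<rho> a) = inv\<^bsub>GL n\<^esub> (\<rho>' a) \<otimes>\<^bsub>GL n\<^esub> P"
        using eqa P cl[OF a]
        by (metis h.H.inv_closed h.H.inv_solve_left h.H.inv_solve_right h.H.m_assoc h.H.m_closed)
      then show "inv\<^bsub>W\<^esub> a \<in> ?H" unfolding mem_Collect_eq h.hom_inv[OF a] h'.hom_inv[OF a] using a by blast
    next
      fix a b assume "a \<in> ?H" "b \<in> ?H"
      then have a: "a \<in> carrier W" and eqa: "P \<otimes>\<^bsub>GL n\<^esub> \<rho> a = \<rho>' a \<otimes>\<^bsub>GL n\<^esub> P"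
        and b: "b \<in> carrier W" and eqb: "P \<otimes>\<^bsub>GL n\<^esub> \<rho> b = \<rho>' b \<otimes>\<^bsub>GL n\<^esub> P" by auto
      have "P \<otimes>\<^bsub>GL n\<^esub> (\<rho> a \<otimes>\<^bsub>GL n\<^esub> \<rho> b) = (\<rho>' a \<otimes>\<^bsub>GL n\<^esub> \<rho>' b) \<otimes>\<^bsub>GL n\<^esub> P"
        using eqa eqb P cl[OF a] cl[OF b] by (metis h.H.m_assoc)
      then show "a \<otimes>\<^bsub>W\<^esub> b \<in> ?H"
        unfolding mem_Collect_eq h.hom_mult[OF a b] h'.hom_mult[OF a b] using a b by blast
    qed auto
    moreover have "\<alpha> \<in> ?H" "\<beta> \<in> ?H"
      using inter[OF c(1) c(2) companion_carrier A A'[unfolded eq]]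
        inter[OF c(1) c(2) companion_carrier B B'[unfolded eq]] by auto
    ultimately have "?H = carrier W" by (intro generated_\<alpha>_\<beta>)
    then have "\<forall>g\<in>carrier W. P * \<rho> g = \<rho>' g * P" by auto
    then show "equivalent_rep W n \<rho> \<rho>'" unfolding equivalent_rep_def using P by auto
  }
qed

text \<open>The two companion matrices are written down from \<zeta> and \<open>S\<close>. They
  satisfy the relations of \<alpha> and \<beta> because A^n and B^m are scalar, and B A^(-1) is a
  reflection because the matrices differ in one column only.\<close>

lemma rep_exists:
  assumes adm: "admissible \<zeta> S"
  shows "\<exists>\<rho>. reflection_rep W R n \<rho> \<and> invariant \<rho> = ({\<zeta>}, S)"
proof -
  have \<zeta>: "\<zeta> ^ k = 1" "\<zeta> \<noteq> 1" and S: "S \<subseteq> {z. z ^ m = (base \<zeta> ^ t) ^ m}" "card S = n" "\<Prod>S = (base \<zeta> ^ t) ^ n"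
    using adm by (auto simp: admissible_def root_sets_def)
  define \<mu> where "\<mu> = (base \<zeta> ^ m) ^ s"
  define \<kappa> where "\<kappa> = (base \<zeta> ^ t) ^ m"
  have nz: "base \<zeta> \<noteq> 0" "\<mu> \<noteq> 0" "\<kappa> \<noteq> 0" using base_nz[OF \<zeta>(1)] by (auto simp: \<mu>_def \<kappa>_def)
  define A where "A = companion n (coeffs_\<alpha> \<zeta>)"
  define B where "B = companion n (coeffs_\<beta> S)"
  have Ac: "A \<in> carrier_mat n n" and Bc: "B \<in> carrier_mat n n" by (simp_all add: A_def B_def)
  have A_pow: "A ^\<^sub>m n = \<mu> \<cdot>\<^sub>m 1\<^sub>m n"
  proof -
    have "companion_poly n (coeffs_\<alpha> \<zeta>) = monom 1 n - [:\<mu>:]"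
      by (rule poly_eqI) (use n2 in \<open>auto simp: coeff_companion_poly coeffs_\<alpha>_def \<mu>_def coeff_pCons split: nat.splits\<close>)
    then show ?thesis unfolding A_def companion_pow_scalar[OF n_pos] by simp
  qed
  have B_pow: "B ^\<^sub>m m = \<kappa> \<cdot>\<^sub>m 1\<^sub>m n"
    unfolding B_def companion_pow_scalar[OF n_pos] companion_poly_coeffs_\<beta>[OF S(2)]
    by (rule prod_linear_dvd_binomial) (use S(1) nz m1 in \<open>auto simp: \<kappa>_def\<close>)
  have detA: "det A \<noteq> 0" by (rule det_nonzero_of_pow[OF Ac A_pow nz(2) n_pos])
  have detB: "det B \<noteq> 0" by (rule det_nonzero_of_pow[OF Bc B_pow nz(3) m1])
  interpret GL: group "GL n" by (rule group_GL)
  let ?A' = "inv\<^bsub>GL n\<^esub> A"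
  note A' = GL_inv[OF Ac detA]
  \<comment> \<open>The difference of the first columns, so that B v = A v + v_0 g. Consequently B
    A^(-1) = 1 + g f^T, with f the row of index 0 of A^(-1).\<close>
  define g where "g = vec n (\<lambda>i. coeffs_\<beta> S i - coeffs_\<alpha> \<zeta> i)"
  define f where "f = row ?A' 0"
  have g: "g \<in> carrier_vec n" by (simp add: g_def)
  have f: "f \<in> carrier_vec n" unfolding f_def by (rule row_carrier_vec[OF _ A'(1)]) (use n2 in simp)
  have fv: "(?A' *\<^sub>v v) $ 0 = f \<bullet> v" for v using A'(1) n2 by (simp add: f_def)
  have B_vec: "B *\<^sub>v v = A *\<^sub>v v + (v $ 0) \<cdot>\<^sub>v g" if v: "v \<in> carrier_vec n" for v
  proof (rule eq_vecI)
    fix i assume "i < dim_vec (A *\<^sub>v v + (v $ 0) \<cdot>\<^sub>v g)"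
    then have i: "i < n" using g by simp
    have "(A *\<^sub>v v + (v $ 0) \<cdot>\<^sub>v g) $ i = (A *\<^sub>v v) $ i + v $ 0 * g $ i"
      using i g by (simp del: index_mult_mat_vec)
    then show "(B *\<^sub>v v) $ i = (A *\<^sub>v v + (v $ 0) \<cdot>\<^sub>v g) $ i"
      using i unfolding A_def B_def companion_mult_vec[OF v i] by (simp add: g_def algebra_simps)
  qed (use Ac Bc g in simp)
  define M where "M = B * ?A'"
  have Mc: "M \<in> carrier_mat n n" unfolding M_def by (rule mult_carrier_mat[OF Bc A'(1)])
  have M_vec: "M *\<^sub>v v = v + (f \<bullet> v) \<cdot>\<^sub>v g" if v: "v \<in> carrier_vec n" for v
  proof -
    have w: "?A' *\<^sub>v v \<in> carrier_vec n" by (rule mult_mat_vec_carrier[OF A'(1) v])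
    have "M *\<^sub>v v = A *\<^sub>v (?A' *\<^sub>v v) + (f \<bullet> v) \<cdot>\<^sub>v g"
      unfolding M_def assoc_mult_mat_vec[OF Bc A'(1) v] B_vec[OF w] fv ..
    also have "A *\<^sub>v (?A' *\<^sub>v v) = v"
      using assoc_mult_mat_vec[OF Ac A'(1) v] A'(3) v by simp
    finally show ?thesis .
  qed
  \<comment> \<open>\<open>A\<close> sends entry 0, multiplied by \<mu>, to the last entry. The last
    entry of g = A (A^(-1) g) therefore yields f g = \<zeta> - 1 without an explicit inverse of
    \<open>A\<close>.\<close>
  have g_last: "g $ (n - 1) = \<mu> * (\<zeta> - 1)"
  proof -
    have "(base \<zeta> ^ t) ^ n = base \<zeta> ^ (n * t)" by (simp add: mult.commute flip: power_mult)
    also have "\<dots> = base \<zeta> * \<mu>" unfolding st0 \<mu>_def by (simp add: power_mult)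
    finally have "coeffs_\<beta> S (n - 1) = ((-1) ^ (n + 1) * (-1) ^ (n + 1)) * (\<zeta> * \<mu>)"
      unfolding coeffs_\<beta>_last[OF S(2)] S(3) by (simp add: base_def)
    also have "(-1) ^ (n + 1) * (-1) ^ (n + 1) = (1::complex)" by (simp flip: power_add)
    finally show ?thesis using n2 by (simp add: g_def coeffs_\<alpha>_def \<mu>_def algebra_simps)
  qed
  have A_last: "(A *\<^sub>v v) $ (n - 1) = \<mu> * v $ 0" if v: "v \<in> carrier_vec n" for v
    using companion_mult_vec[OF v, of "n - 1" "coeffs_\<alpha> \<zeta>"] n2 unfolding A_def
    by (simp add: coeffs_\<alpha>_def \<mu>_def del: index_mult_mat_vec)
  have fg: "f \<bullet> g = \<zeta> - 1"
  proof -
    have w: "?A' *\<^sub>v g \<in> carrier_vec n" by (rule mult_mat_vec_carrier[OF A'(1) g])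
    have "A *\<^sub>v (?A' *\<^sub>v g) = g" using assoc_mult_mat_vec[OF Ac A'(1) g] A'(3) g by simp
    then have "\<mu> * (f \<bullet> g) = \<mu> * (\<zeta> - 1)" using A_last[OF w] g_last fv[of g] by simp
    then show ?thesis using nz by simp
  qed
  have M_pow: "M ^\<^sub>m k = 1\<^sub>m n" by (rule reflection_pow_one[OF Mc g f M_vec fg \<zeta>(2,1)])
  have M_fix: "fixes_hyperplane n M"
    unfolding fixes_hyperplane_def
  proof (intro bexI[OF _ f] ballI impI)
    fix v assume v: "v \<in> carrier_vec n" "f \<bullet> v = 0"
    have "0 \<cdot>\<^sub>v g = 0\<^sub>v n" using g by (intro eq_vecI) simp_all
    then show "M *\<^sub>v v = v" unfolding M_vec[OF v(1)] v(2) using v(1) by simp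
  qed
  have AG: "A \<in> carrier (GL n)" and BG: "B \<in> carrier (GL n)" using Ac Bc detA detB by auto
  have scal: "(z \<cdot>\<^sub>m 1\<^sub>m n) * N = N * (z \<cdot>\<^sub>m 1\<^sub>m n)" if N: "N \<in> carrier_mat n n" for z :: complex and N
    using N by (simp add: mult_smult_distrib[OF N, of _ n] mult_smult_assoc_mat[of _ n n])
  define y where "y j = A [^]\<^bsub>GL n\<^esub> j \<otimes>\<^bsub>GL n\<^esub> (B \<otimes>\<^bsub>GL n\<^esub> ?A') \<otimes>\<^bsub>GL n\<^esub> inv\<^bsub>GL n\<^esub> (A [^]\<^bsub>GL n\<^esub> j)" for j :: nat
  have yM: "y j = A [^]\<^bsub>GL n\<^esub> j * M * inv\<^bsub>GL n\<^esub> (A [^]\<^bsub>GL n\<^esub> j)" for j by (simp add: y_def M_def)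
  have pair: "toric_tuple (GL n) k n m y" "consecutive_prod (GL n) y 0 m [^]\<^bsub>GL n\<^esub> s = A"
    "consecutive_prod (GL n) y 0 n [^]\<^bsub>GL n\<^esub> t = B"
  proof -
    have 1: "A [^]\<^bsub>GL n\<^esub> n \<otimes>\<^bsub>GL n\<^esub> B = B \<otimes>\<^bsub>GL n\<^esub> A [^]\<^bsub>GL n\<^esub> n"
      by (simp add: GL_pow[OF Ac] A_pow scal[OF Bc])
    have 2: "B [^]\<^bsub>GL n\<^esub> m \<otimes>\<^bsub>GL n\<^esub> A = A \<otimes>\<^bsub>GL n\<^esub> B [^]\<^bsub>GL n\<^esub> m"
      by (simp add: GL_pow[OF Bc] B_pow scal[OF Ac])
    have 3: "(B \<otimes>\<^bsub>GL n\<^esub> ?A') [^]\<^bsub>GL n\<^esub> k = \<one>\<^bsub>GL n\<^esub>"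
      using GL_pow[OF Mc] M_pow by (simp add: M_def)
    have 4: "(A [^]\<^bsub>GL n\<^esub> n) [^]\<^bsub>GL n\<^esub> t = (B [^]\<^bsub>GL n\<^esub> m) [^]\<^bsub>GL n\<^esub> s"
    proof -
      \<comment> \<open>Both are \<open>base \<zeta>\<close> to the power m s t.\<close>
      have "\<mu> ^ t = \<kappa> ^ s" by (simp add: \<mu>_def \<kappa>_def mult_ac flip: power_mult)
      then show ?thesis
        using GL_pow[of "\<mu> \<cdot>\<^sub>m 1\<^sub>m n" n t] GL_pow[of "\<kappa> \<cdot>\<^sub>m 1\<^sub>m n" n s]
        by (simp add: GL_pow[OF Ac] GL_pow[OF Bc] A_pow B_pow smult_one_pow)
    qed
    note GL.toric_tuple_of_pair[OF AG BG st0 1 2 3 4, folded y_def]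
    then show "toric_tuple (GL n) k n m y" "consecutive_prod (GL n) y 0 m [^]\<^bsub>GL n\<^esub> s = A"
      "consecutive_prod (GL n) y 0 n [^]\<^bsub>GL n\<^esub> t = B" unfolding y_def by auto
  qed
  obtain h where hom: "h \<in> hom W (GL n)" and hx: "\<And>j. h (x j) = y j"
    using hom_of_toric_tuple[OF group_GL pair(1) n_pos] by blast
  interpret h: group_hom W "GL n" h by (rule hom_GL[OF hom])
  have h_prod: "h (consecutive_prod W x i l) = consecutive_prod (GL n) y i l" for i l
  proof (induction l)
    case (Suc l)
    have "h (consecutive_prod W x i (Suc l)) = h (consecutive_prod W x i l) \<otimes>\<^bsub>GL n\<^esub> h (x (i + l))"
      unfolding consecutive_prod.simps by (rule h.hom_mult) (use toric_gen_closed[OF n_pos] in auto)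
    then show ?case using Suc hx by simp
  qed (use h.hom_one in simp)
  have h\<alpha>: "h \<alpha> = A"
    using h.hom_nat_pow[OF closed(1), of s] pair(2) h_prod[of 0 m] by (simp add: \<alpha>_def Z_def)
  have h\<beta>: "h \<beta> = B"
    using h.hom_nat_pow[of "consecutive_prod W x 0 n" t] pair(3) h_prod[of 0 n] toric_gen_closed[OF n_pos]
    by (simp add: \<beta>_def)
  have y_fix: "fixes_hyperplane n (y j)" for j
    unfolding yM by (rule fixes_hyperplane_conj[OF GL.nat_pow_closed[OF AG] Mc M_fix])
  have rep: "reflection_rep W R n h"
    unfolding reflection_rep_def
  proof (intro conjI ballI impI)
    fix r assume "r \<in> R"
    then obtain i a l where i: "i \<in> {1..n}" and a: "a \<in> carrier W"
      and r: "r = a \<otimes>\<^bsub>W\<^esub> toric_gen k n m i [^]\<^bsub>W\<^esub> (l::int) \<otimes>\<^bsub>W\<^esub> inv\<^bsub>W\<^esub> a"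
      by (auto simp: toric_reflections_def Let_def)
    have i': "toric_gen k n m i = x (i - 1)" using i by simp
    have "h r = h a \<otimes>\<^bsub>GL n\<^esub> y (i - 1) [^]\<^bsub>GL n\<^esub> l \<otimes>\<^bsub>GL n\<^esub> inv\<^bsub>GL n\<^esub> (h a)"
      unfolding r i' using a h.hom_int_pow[OF toric_gen_closed[OF n_pos]] hx[of "i - 1"]
      by (simp only: h.hom_mult h.hom_inv h.hom_int_pow toric_gen_closed[OF n_pos]
          m_closed inv_closed int_pow_closed)
    then have hr: "h r = h a * y (i - 1) [^]\<^bsub>GL n\<^esub> l * inv\<^bsub>GL n\<^esub> (h a)" by simp
    have yc: "y (i - 1) \<in> carrier (GL n)" using h.hom_closed[OF toric_gen_closed[OF n_pos]] hx[of "i - 1"] by metis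
    then have "y (i - 1) [^]\<^bsub>GL n\<^esub> l \<in> carrier_mat n n" using GL.int_pow_closed by (metis GL_simps(1))
    then show "fixes_hyperplane n (h r)"
      unfolding hr by (intro fixes_hyperplane_conj h.hom_closed a fixes_hyperplane_int_pow yc y_fix)
  next
    fix v :: "complex vec" assume v: "v \<in> carrier_vec n" and inv: "\<forall>g\<in>carrier W. h g *\<^sub>v v = v"
    have Av: "A *\<^sub>v v = v" and Bv: "B *\<^sub>v v = v" using inv closed h\<alpha> h\<beta> by auto
    \<comment> \<open>A v = B v forces v_0 g = 0, and the last entry of g is nonzero. With v_0 = 0
      the matrix \<open>A\<close> only shifts v, so A v = v carries the zero from each entry to the
      next.\<close>
    have "v $ i = (v + (v $ 0) \<cdot>\<^sub>v g) $ i" for i using B_vec[OF v] unfolding Av Bv by simp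
    from this[of "n - 1"] have "v $ 0 * g $ (n - 1) = 0" using v g n2 by simp
    then have v0: "v $ 0 = 0" using g_last nz \<zeta> by simp
    have "i < n \<Longrightarrow> v $ i = 0" for i
    proof (induction i)
      case (Suc i)
      then have "(A *\<^sub>v v) $ i = v $ Suc i"
        unfolding A_def using companion_mult_vec[OF v, of i] v0 by (simp del: index_mult_mat_vec)
      then show ?case using Suc Av by simp
    qed (rule v0)
    then show "v = 0\<^sub>v n" using v by (intro eq_vecI) auto
  qed (rule hom)
  \<comment> \<open>The first component is thereby a singleton, so it suffices to exhibit \<zeta> as
    an eigenvalue of x_n.\<close>
  obtain \<zeta>' S' where inv: "invariant h = ({\<zeta>'}, S')" using rep_normal_form[OF rep] by blast
  have S': "S' = S" using inv spectrum_coeffs_\<beta>[OF S(2)] by (simp add: invariant_def h\<beta> B_def)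
  have "\<zeta> \<in> spectrum (h (x (n - 1)))"
  proof -
    let ?X = "h (x (n - 1))"
    have Xc: "?X \<in> carrier_mat n n" using h.hom_closed[OF toric_gen_closed[OF n_pos]] by (metis GL_simps(1))
    \<comment> \<open>The image of x_n is A^(-1) B whereas \<open>M\<close> is B A^(-1); conjugation
      by \<open>A\<close> takes one to the other, and g is an eigenvector of
      \<open>M\<close>.\<close>
    have "h \<alpha> \<otimes>\<^bsub>GL n\<^esub> ?X = h (\<alpha> \<otimes>\<^bsub>W\<^esub> x (n - 1))"
      by (rule h.hom_mult[symmetric, OF closed(2) toric_gen_closed[OF n_pos]])
    then have "A * ?X = B" unfolding \<alpha>_y_last h\<alpha> h\<beta> by simp
    moreover have "M * A = B"
      unfolding M_def using assoc_mult_mat[OF Bc A'(1) Ac] A'(2) Bc by simp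
    ultimately have "spectrum ?X = spectrum M" by (intro spectrum_conj[OF Xc Mc Ac detA]) simp
    moreover have "eigenvector M g \<zeta>"
    proof -
      have "M *\<^sub>v g = g + (\<zeta> - 1) \<cdot>\<^sub>v g" unfolding M_vec[OF g] fg ..
      also have "\<dots> = \<zeta> \<cdot>\<^sub>v g" by (intro eq_vecI) (auto simp: algebra_simps)
      finally have "M *\<^sub>v g = \<zeta> \<cdot>\<^sub>v g" .
      moreover have "g \<noteq> 0\<^sub>v n" using g_last nz \<zeta> n2 by auto
      ultimately show ?thesis using Mc g by (simp add: eigenvector_def)
    qed
    ultimately show ?thesis by (auto simp: spectrum_def eigenvalue_def)
  qed
  then have "\<zeta> \<in> fst (invariant h)" using \<zeta>(2) by (simp add: invariant_def)
  then have "\<zeta>' = \<zeta>" unfolding inv by simp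
  then have "invariant h = ({\<zeta>}, S)" using inv S' by simp
  then show ?thesis using rep by blast
qed

section \<open>Counting the invariants, and the values of characters\<close>

definition invariants where "invariants = {({\<zeta>}, S) |\<zeta> S. admissible \<zeta> S}"

text \<open>There are k - 1 choices of \<zeta>, and the number of sets \<open>S\<close> is the same
  for each of them; multiplying by m avoids a division of natural numbers.\<close>

lemma card_invariants:
  "finite invariants" "m * card invariants = (k - 1) * (m choose n)"
proof -
  let ?U = "{\<zeta>::complex. \<zeta> ^ k = 1} - {1}"
  have fin: "finite {\<zeta>::complex. \<zeta> ^ k = 1}" and card: "card {\<zeta>::complex. \<zeta> ^ k = 1} = k"
    using card_roots_unity_eq[of k] k2 by (auto intro: card_ge_0_finite)
  have U: "finite ?U" "card ?U = k - 1" using fin card by auto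
  let ?D = "Sigma ?U (\<lambda>\<zeta>. root_sets n m (base \<zeta> ^ t))"
  have inv: "invariants = (\<lambda>(\<zeta>, S). ({\<zeta>}, S)) ` ?D"
  proof (intro equalityI subsetI)
    fix p assume "p \<in> invariants"
    then obtain \<zeta> S where p: "p = ({\<zeta>}, S)" and "admissible \<zeta> S" unfolding invariants_def by blast
    then have "(\<zeta>, S) \<in> ?D" by (simp add: admissible_def)
    then show "p \<in> (\<lambda>(\<zeta>, S). ({\<zeta>}, S)) ` ?D" unfolding p by (rule rev_image_eqI) simp
  next
    fix p assume "p \<in> (\<lambda>(\<zeta>, S). ({\<zeta>}, S)) ` ?D"
    then obtain \<zeta> S where "p = ({\<zeta>}, S)" "(\<zeta>, S) \<in> ?D" by auto
    then show "p \<in> invariants" unfolding invariants_def by (auto simp: admissible_def)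
  qed
  have root: "finite (root_sets n m (base \<zeta> ^ t))" "m * card (root_sets n m (base \<zeta> ^ t)) = m choose n"
    if "\<zeta> \<in> ?U" for \<zeta>
    using card_root_sets[OF st0, of "base \<zeta> ^ t"] base_nz[of \<zeta>] that m1 by auto
  show "finite invariants" unfolding inv using U root(1) by (intro finite_imageI finite_SigmaI) auto
  have "card invariants = card ?D" unfolding inv by (intro card_image) (auto simp: inj_on_def)
  also have "\<dots> = (\<Sum>\<zeta>\<in>?U. card (root_sets n m (base \<zeta> ^ t)))" using U root(1) by (intro card_SigmaI) auto
  finally have "m * card invariants = (\<Sum>\<zeta>\<in>?U. m * card (root_sets n m (base \<zeta> ^ t)))"
    by (simp add: sum_distrib_left)
  also have "\<dots> = (\<Sum>\<zeta>\<in>?U. m choose n)" using root(2) by (intro sum.cong) auto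
  finally show "m * card invariants = (k - 1) * (m choose n)" using U by simp
qed

text \<open>Generators go to k-th roots of unity and the target is commutative. All group elements
  are covered because an isomorphism may send a generator of one group to any element of the
  other.\<close>

lemma character_pow:
  assumes h: "h \<in> hom W Cstar" and g: "g \<in> carrier W"
  shows "h g ^ k = 1"
proof -
  interpret h: group_hom W Cstar h
    using h group_Cstar by (intro group_hom.intro group_hom_axioms.intro) (auto intro: group_toric_group)
  let ?H = "{g \<in> carrier W. h g ^ k = 1}"
  have "subgroup ?H W"
  proof (rule subgroupI)
    show "?H \<noteq> {}" using h.hom_one by (auto intro!: exI[of _ "\<one>\<^bsub>W\<^esub>"])
    show "inv\<^bsub>W\<^esub> a \<in> ?H" if "a \<in> ?H" for a
    proof -
      have "h (inv\<^bsub>W\<^esub> a) * h a = 1" using that h.hom_mult[of "inv\<^bsub>W\<^esub> a" a] h.hom_one by simp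
      then have "h (inv\<^bsub>W\<^esub> a) ^ k * h a ^ k = 1" by (simp flip: power_mult_distrib)
      then show ?thesis using that by simp
    qed
    show "a \<otimes>\<^bsub>W\<^esub> b \<in> ?H" if "a \<in> ?H" "b \<in> ?H" for a b
      using that h.hom_mult[of a b] by (simp add: power_mult_distrib)
  qed auto
  moreover have "x j \<in> ?H" for j
    using h.hom_nat_pow[OF toric_gen_closed[OF n_pos], of "Suc j" k] ypow[of j] toric_gen_closed[OF n_pos] h.hom_one
    by (simp add: Cstar_pow)
  ultimately show ?thesis using toric_group_generated[OF n_pos] g by blast
qed

text \<open>For a constant tuple in a commutative group the product relation only compares lengths,
  so every k-th root of unity is allowed.\<close>

lemma character_exists:
  assumes "\<zeta> ^ k = 1"
  shows "\<exists>h\<in>hom W Cstar. h (x 0) = \<zeta>"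
proof -
  have "\<zeta> \<noteq> 0" using assms k2 by (auto simp: power_0_left)
  have "consecutive_prod Cstar (\<lambda>_. \<zeta>) i l = \<zeta> ^ l" for i l by (induction l) auto
  then have "toric_tuple Cstar k n m (\<lambda>_. \<zeta>)"
    using assms \<open>\<zeta> \<noteq> 0\<close> by (simp add: toric_tuple_def Cstar_pow)
  then show ?thesis using hom_of_toric_tuple[OF group_Cstar _ n_pos] by blast
qed

lemma invariants_nonempty: "n \<le> m \<Longrightarrow> invariants \<noteq> {}"
  using card_invariants(2) k2 m1 by force

end

text \<open>Pulling back representations bounds each parameter on one side; the inverse isomorphism
  supplies the other bound. The number of classes depends on all three parameters, so m is compared
  once k and n agree.\<close>

lemma parameters_le:
  assumes "toric k n m s t" and "toric k' n' m' s' t'" and nm: "n < m" "n' < m'"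
    and iso: "reflection_isomorphic (toric_group k n m) (toric_reflections k n m)
      (toric_group k' n' m') (toric_reflections k' n' m')"
  shows "k' \<le> k" "n' \<le> n" "k' = k \<Longrightarrow> n' = n \<Longrightarrow> m' \<le> m"
proof -
  interpret T: toric k n m s t by fact
  interpret T': toric k' n' m' s' t' by fact
  obtain \<phi> where \<phi>: "\<phi> \<in> iso T.W T'.W" and R: "\<phi> ` T.R = T'.R"
    using iso by (auto simp: reflection_isomorphic_def)
  have \<phi>_hom: "\<phi> \<in> hom T.W T'.W" and surj: "\<phi> ` carrier T.W = carrier T'.W"
    using \<phi> by (auto simp: iso_def bij_betw_def)
  \<comment> \<open>Values of characters are compared: a k'-th root of unity is a value of a
    character of the second group, hence of a pulled-back character of the first.\<close>
  have "\<zeta> ^ k = 1" if \<zeta>: "\<zeta> ^ k' = 1" for \<zeta> :: complex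
  proof -
    obtain h where h: "h \<in> hom T'.W Cstar" "h (T'.x 0) = \<zeta>" using T'.character_exists[OF \<zeta>] by blast
    have "T'.x 0 \<in> \<phi> ` carrier T.W" unfolding surj by (rule toric_gen_closed[OF T'.n_pos])
    then obtain g where g: "g \<in> carrier T.W" "\<phi> g = T'.x 0" by force
    have "h \<circ> \<phi> \<in> hom T.W Cstar" by (rule hom_compose[OF \<phi>_hom h(1)])
    from T.character_pow[OF this g(1)] show ?thesis using g h by simp
  qed
  then have "card {z::complex. z ^ k' = 1} \<le> card {z::complex. z ^ k = 1}"
    using card_roots_unity_eq[of k] T.k2 by (intro card_mono) (auto intro: card_ge_0_finite)
  then show "k' \<le> k" using card_roots_unity_eq[of k] card_roots_unity_eq[of k'] T.k2 T'.k2 by simp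
  obtain \<zeta> S where "T'.admissible \<zeta> S"
    using T'.invariants_nonempty nm by (auto simp: T'.invariants_def)
  then obtain \<rho> where "reflection_rep T'.W T'.R n' \<rho>" using T'.rep_exists by blast
  then show "n' \<le> n" by (rule T.dimension_le[OF reflection_rep_pullback[OF \<phi> R]])
  show "m' \<le> m" if kn: "k' = k" "n' = n"
  proof -
    have "\<forall>p\<in>T'.invariants. \<exists>\<rho>. reflection_rep T'.W T'.R n' \<rho> \<and> T'.invariant \<rho> = p"
      using T'.rep_exists by (auto simp: T'.invariants_def)
    then obtain \<rho> where \<rho>: "\<And>p. p \<in> T'.invariants \<Longrightarrow> reflection_rep T'.W T'.R n' (\<rho> p)"
      "\<And>p. p \<in> T'.invariants \<Longrightarrow> T'.invariant (\<rho> p) = p" by metis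
    \<comment> \<open>One representation is chosen for each invariant of the second group and pulled
      back. The map is injective because equivalence can be tested before or after the pullback, and
      invariants decide it on both sides.\<close>
    let ?F = "\<lambda>p. T.invariant (\<rho> p \<circ> \<phi>)"
    have rep: "reflection_rep T.W T.R n (\<rho> p \<circ> \<phi>)" if "p \<in> T'.invariants" for p
      using reflection_rep_pullback[OF \<phi> R \<rho>(1)[OF that]] kn by simp
    have "?F ` T'.invariants \<subseteq> T.invariants"
      using T.rep_normal_form[OF rep] by (fastforce simp: T.invariants_def)
    moreover have "inj_on ?F T'.invariants"
    proof (rule inj_onI)
      fix p q assume p: "p \<in> T'.invariants" and q: "q \<in> T'.invariants" and "?F p = ?F q"
      then have "equivalent_rep T.W n (\<rho> p \<circ> \<phi>) (\<rho> q \<circ> \<phi>)"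
        using T.equivalent_rep_iff_invariant[OF rep[OF p] rep[OF q]] by simp
      then have "equivalent_rep T'.W n' (\<rho> p) (\<rho> q)"
        using equivalent_rep_pullback[OF \<phi>] kn by blast
      then show "p = q"
        using T'.equivalent_rep_iff_invariant[OF \<rho>(1)[OF p] \<rho>(1)[OF q]] \<rho>(2)[OF p] \<rho>(2)[OF q] by simp
    qed
    ultimately have "card T'.invariants \<le> card T.invariants"
      using T.card_invariants(1) by (intro card_inj_on_le)
    then show ?thesis
      using le_of_scaled_binomial[of n m m' "k - 1" "card T.invariants" "card T'.invariants"]
        T.n2 T.k2 nm kn T.card_invariants(2) T'.card_invariants(2) by simp
  qed
qed

text \<open>Bezout's identity is oriented so that n t exceeds m s, with natural exponents s and t;
  \<alpha> and \<beta> are then positive words in the generators.\<close>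

lemma toric_bezout:
  fixes n m :: nat
  assumes "n \<ge> 2" "coprime n m"
  obtains s t where "n * t = m * s + 1"
proof -
  obtain d t s where "d dvd n" "d dvd m" "n * t = m * s + d"
    using bezout_add_strong_nat[of n m] assms(1) by auto
  moreover from this have "d = 1" using assms(2) by (metis coprime_common_divisor_nat)
  ultimately show thesis using that by blast
qed

lemma toric_reflections_subset:
  assumes "n \<ge> 1"
  shows "toric_reflections k n m \<subseteq> carrier (toric_group k n m)"
proof -
  interpret group "toric_group k n m" by (rule group_toric_group)
  show ?thesis using toric_gen_closed[OF assms] by (auto simp: toric_reflections_def Let_def)
qed

theorem theorem1p2:
  fixes k k' n n' m m' :: nat
  assumes "k \<ge> 2" "k' \<ge> 2" "n \<ge> 2" "n' \<ge> 2" "m \<ge> 2" "m' \<ge> 2"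
    and "n < m" "n' < m'" "coprime n m" "coprime n' m'"
  shows "reflection_isomorphic (toric_group k n m) (toric_reflections k n m)
           (toric_group k' n' m') (toric_reflections k' n' m')
         \<longleftrightarrow> k = k' \<and> n = n' \<and> m = m'"
proof
  assume iso: "reflection_isomorphic (toric_group k n m) (toric_reflections k n m)
      (toric_group k' n' m') (toric_reflections k' n' m')"
  have iso': "reflection_isomorphic (toric_group k' n' m') (toric_reflections k' n' m')
      (toric_group k n m) (toric_reflections k n m)"
    by (rule reflection_isomorphic_sym[OF group_toric_group toric_reflections_subset iso]) (use assms in simp)
  obtain s t where "n * t = m * s + 1" using toric_bezout assms by metis
  then have T: "toric k n m s t" using assms by unfold_locales auto
  obtain s' t' where "n' * t' = m' * s' + 1" using toric_bezout assms by metis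
  then have T': "toric k' n' m' s' t'" using assms by unfold_locales auto
  show "k = k' \<and> n = n' \<and> m = m'"
    using parameters_le[OF T T' assms(7,8) iso] parameters_le[OF T' T assms(8,7) iso'] by simp
next
  assume "k = k' \<and> n = n' \<and> m = m'"
  then show "reflection_isomorphic (toric_group k n m) (toric_reflections k n m)
      (toric_group k' n' m') (toric_reflections k' n' m')"
    unfolding reflection_isomorphic_def using iso_set_refl by (intro bexI[of _ "\<lambda>g. g"]) auto
qed

end
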